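(* Let $d\ge1$ be an integer, $\kappa\in(0,1)$, and let $p,s,\beta$ be real numbers with $1<p<\infty$, $0<sp-\beta<d$ and $d+sp\ge0$. Suppose $D\neq\emptyset$ is a proper $\kappa$-plump open set in $\mathbb{R}^d$ such that $\partial D$ is $(s-\beta/p,p)$-uniformly fat, or, in case $D$ is bounded, such that $\partial D$ is $(s-\beta/p,p)$-locally uniformly fat. Then $D$ admits an $(s,p,\beta)$-Hardy inequality, i.e. there is a constant $c>0$ such that for all $u\in C_0^\infty(D)$ $$\int_D\frac{|u(x)|^p}{\delta_x^{sp}}\,\delta_x^\beta\,dx\le c\int_D\int_D\frac{|u(x)-u(y)|^p}{|x-y|^{d+sp}}\,\delta_x^\beta\,dy\,dx .$$
   Context: $\delta_x=\mathrm{dist}(x,\mathbb{R}^d\setminus D)$; $C_0^\infty(D)$ is the space of smooth functions with compact support in $D$; $B(x,r)$ is the open and $\bar B(x,r)$ the closed Euclidean ball; diameters may be $+\infty$. Plumpness: a set $A\subset\mathbb{R}^d$ is $\kappa$-plump with $\kappa\in(0,1)$ if for each $0<r<\mathrm{diam}(A)$ and each $x\in\overline{A}$ there is $z\in\bar B(x,r)$ with $B(z,\kappa r)\subset A$. Hausdorff content: $\mathcal{H}^\lambda_\infty(E)=\inf\{\sum_{i}r_i^\lambda : E\subset\bigcup_{i}B(x_i,r_i),\ r_i>0\}$, the infimum being over countable (finite or infinite) covers by balls. Fatness: let $1<p<\infty$ and $0<\sigma<d/p$. The boundary $\partial D$ is $(\sigma,p)$-uniformly fat if there are $d-\sigma p<\lambda\le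 d$ and $C>0$ such that $\mathcal{H}^\lambda_\infty(B(x,R)\cap\partial D)\ge CR^\lambda$ for all $x\in\partial D$ and all $R>0$. For a bounded open set $D$, $\partial D$ is $(\sigma,p)$-locally uniformly fat if there are $d-\sigma p<\lambda\le d$ and $C>0$ such that the same inequality holds for all $x\in\partial D$ and $0<R<2\,\mathrm{diam}(\partial D)<\infty$. *)

theory Defs
  imports "HOL-Analysis.Analysis"
begin

(* The library's diameter is only meaningful on bounded sets, hence this
   extended variant: it is \<infinity> on unbounded sets. *)
definition ediam :: "'a::metric_space set \<Rightarrow> ennreal" where
  "ediam A = (SUP x\<in>A. SUP y\<in>A. ennreal (dist x y))"

definition plump :: "real \<Rightarrow> 'a::euclidean_space set \<Rightarrow> bool" where
  "plump \<kappa> A \<longleftrightarrow>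
     (\<forall>r x. 0 < r \<longrightarrow> ennreal r < ediam A \<longrightarrow> x \<in> closure A \<longrightarrow>
        (\<exists>z\<in>cball x r. ball z (\<kappa> * r) \<subseteq> A))"

(* The index set I ranges over all sets of naturals, so that finite (also empty)
   and countably infinite covers are both allowed. *)
definition hausdorff_content :: "real \<Rightarrow> 'a::euclidean_space set \<Rightarrow> ennreal" where
  "hausdorff_content lam E =
     Inf {(\<Sum>\<^sub>\<infinity>i\<in>I. ennreal (r i powr lam)) | I x r.
            (\<forall>i\<in>(I :: nat set). 0 < r i) \<and> E \<subseteq> (\<Union>i\<in>I. ball (x i) (r i))}"

(* In the two fatness predicates, F is the boundary of the domain. They are meant
   for 1 < p and 0 < \<sigma> < d/p. *)
definition uniformly_fat :: "real \<Rightarrow> real \<Rightarrow> 'a::euclidean_space set \<Rightarrow> bool" where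
  "uniformly_fat \<sigma> p F \<longleftrightarrow>
     (\<exists>lam C. real DIM('a) - \<sigma> * p < lam \<and> lam \<le> real DIM('a) \<and> 0 < C \<and>
        (\<forall>x\<in>F. \<forall>R>0. ennreal (C * R powr lam) \<le> hausdorff_content lam (ball x R \<inter> F)))"

definition locally_uniformly_fat :: "real \<Rightarrow> real \<Rightarrow> 'a::euclidean_space set \<Rightarrow> bool" where
  "locally_uniformly_fat \<sigma> p F \<longleftrightarrow>
     ediam F < \<infinity> \<and>
     (\<exists>lam C. real DIM('a) - \<sigma> * p < lam \<and> lam \<le> real DIM('a) \<and> 0 < C \<and>
        (\<forall>x\<in>F. \<forall>R>0. ennreal R < 2 * ediam F \<longrightarrow>
           ennreal (C * R powr lam) \<le> hausdorff_content lam (ball x R \<inter> F)))"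

(* C_k k: all iterated partial derivatives up to order k exist and are continuous
   on the whole space. The condition "f differentiable at x" is the (Frechet) one;
   for continuous partial derivatives it is automatic. *)
primrec C_k :: "nat \<Rightarrow> ('a::euclidean_space \<Rightarrow> real) \<Rightarrow> bool" where
  "C_k 0 f \<longleftrightarrow> continuous_on UNIV f"
| "C_k (Suc k) f \<longleftrightarrow>
     (\<forall>x. f differentiable at x) \<and>
     (\<forall>b\<in>Basis. C_k k (\<lambda>x. frechet_derivative f (at x) b))"

definition smooth :: "('a::euclidean_space \<Rightarrow> real) \<Rightarrow> bool" where
  "smooth f \<longleftrightarrow> (\<forall>k. C_k k f)"

(* Functions on D with compact support in D are identified with their extension
   by zero to the whole space. *)
definition test_functions :: "'a::euclidean_space set \<Rightarrow> ('a \<Rightarrow> real) set" where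
  "test_functions D =
     {u. smooth u \<and> compact (closure {x. u x \<noteq> 0}) \<and> closure {x. u x \<noteq> 0} \<subseteq> D}"

abbreviation bdist :: "'a::euclidean_space set \<Rightarrow> 'a \<Rightarrow> real" where
  "bdist D x \<equiv> infdist x (- D)"

(* The integrals take values in [0, \<infinity>]; the right-hand side may be infinite.
   On the null set x = y the inner integrand is 0. *)
definition hardy_inequality :: "real \<Rightarrow> real \<Rightarrow> real \<Rightarrow> 'a::euclidean_space set \<Rightarrow> bool" where
  "hardy_inequality s p \<beta> D \<longleftrightarrow>
     (\<exists>c>0. \<forall>u\<in>test_functions D.
        (\<integral>\<^sup>+x\<in>D. ennreal (\<bar>u x\<bar> powr p / bdist D x powr (s * p) * bdist D x powr \<beta>) \<partial>lborel)
        \<le> ennreal c *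
          (\<integral>\<^sup>+x\<in>D. (\<integral>\<^sup>+y\<in>D.
             ennreal (\<bar>u x - u y\<bar> powr p / dist x y powr (real DIM('a) + s * p)
                      * bdist D x powr \<beta>) \<partial>lborel) \<partial>lborel))"

end

theory Submission
  imports Defs
begin

text \<open>
  Write \<open>\<delta>\<close> for the distance to the complement of \<open>D\<close>, \<open>d\<close> for the dimension, and \<open>G x\<close>
  (\<open>energy_density\<close>) for the inner integral on the right-hand side of the inequality, so that the
  right-hand side is the integral of \<open>G\<close> over \<open>D\<close>. The theorem follows by integrating a pointwise
  bound (\<open>pointwise_hardy\<close>): with some \<open>\<eta> > 0\<close>, for every test function \<open>u\<close> and every \<open>x\<close> in \<open>D\<close>,
  the quantity \<open>\<bar>u x\<bar>\<^sup>p \<delta>(x)\<^bsup>\<beta> - s p\<^esup>\<close> is at most a constant times the sum of \<open>G x\<close> and the integral of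
  \<open>\<delta>(x)\<^bsup>-d\<^esup> (\<delta>(y) / \<delta>(x))\<^sup>\<eta> G y\<close> over those \<open>y\<close> in \<open>D\<close> with \<open>\<bar>x - y\<bar> \<le> 4 \<delta>(x)\<close>.

  The bound comes from chains. Fix a boundary point \<open>z\<close> with \<open>\<bar>x - z\<bar> \<le> 2 \<delta>(x)\<close>. Plumpness gives, at each
  scale \<open>r\<^sub>k = \<delta>(x) / 2\<^sup>k\<close>, a ball of radius \<open>\<kappa> r\<^sub>k\<close> in \<open>D\<close> whose centre is at distance at most \<open>r\<^sub>k\<close> from \<open>z\<close>;
  on the concentric ball of half the radius, \<open>\<delta>\<close> is comparable to \<open>r\<^sub>k\<close>. Choosing one good point \<open>y\<^sub>k\<close> in each
  of these smaller balls, starting with \<open>y\<^sub>0 = x\<close>, makes each difference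
  \<open>\<bar>u(y\<^sub>k) - u(y\<^sub>k\<^sub>+\<^sub>1)\<bar>\<close> controlled by \<open>G(y\<^sub>k)\<close>, and for \<open>k > 0\<close> also \<open>G(y\<^sub>k)\<close>
  by its average over the \<open>k\<close>-th ball (\<open>plump_chain\<close>). Since \<open>u\<close> vanishes near \<open>z\<close>, the differences telescope
  to \<open>u x\<close>, so one of them is at least a fixed multiple of \<open>\<bar>u x\<bar> q\<^sup>k\<close> for a chosen ratio \<open>q < 1\<close>. If this
  happens at \<open>k = 0\<close> then \<open>G x\<close> already controls \<open>\<bar>u x\<bar>\<close>. Otherwise a ball near \<open>z\<close> of radius
  comparable to \<open>r\<^sub>k\<close> carries a definite amount of energy (\<open>chain_dichotomy\<close>).

  If the second case holds at all \<open>z\<close> in a piece of the boundary near \<open>x\<close>, a disjoint subfamily of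
  these balls can be enlarged to cover the piece, and the fatness exponent \<open>\<lambda>\<close> turns the lower
  bound on the content into a lower bound on the total energy. The strict inequality
  \<open>\<lambda> > d + \<beta> - s p\<close> leaves room for both \<open>q < 1\<close> and the gain \<open>(\<delta>(y) / \<delta>(x))\<^sup>\<eta>\<close>.
  That gain makes the final integration converge: after exchanging the integrals, each \<open>y\<close> is seen
  from the points \<open>x\<close> with \<open>\<bar>x - y\<bar> \<le> 4 \<delta>(x)\<close>, at every scale above \<open>\<delta>(y)\<close>, and the factor sums these
  scales geometrically (\<open>nn_integral_cone_le\<close>).
\<close>

section \<open>Estimates for powers and for inequalities in the extended reals\<close>

lemma le_ennreal_divideI:
  assumes "X * ennreal b \<le> ennreal c * Y" and "0 < b" and "0 \<le> c"
  shows "X \<le> ennreal (c / b) * Y"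
proof -
  have "X = X * ennreal b * ennreal (1 / b)"
    using \<open>0 < b\<close> by (simp add: mult.assoc flip: ennreal_mult')
  also have "\<dots> \<le> ennreal c * Y * ennreal (1 / b)"
    by (intro mult_right_mono assms) simp
  also have "\<dots> = ennreal (c / b) * Y"
    using ennreal_mult'[of c "1 / b"] \<open>0 \<le> c\<close> by (simp add: mult_ac)
  finally show ?thesis .
qed

lemma ennreal_scale_le:
  assumes "ennreal a \<le> ennreal b * Y" and "0 \<le> c"
  shows "ennreal (c * a) \<le> ennreal (c * b) * Y"
  using mult_left_mono[OF assms(1), of "ennreal c"] assms(2)
  by (simp add: ennreal_mult' mult.assoc)

lemma ennreal_scale_trans:
  assumes "X \<le> ennreal a * Y" and "Y \<le> ennreal b * Z" and "0 \<le> a"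
  shows "X \<le> ennreal (a * b) * Z"
  using order_trans[OF assms(1) mult_left_mono[OF assms(2)]] assms(3)
  by (simp add: ennreal_mult' mult.assoc)

lemma powr_le_max_endpoints:
  fixes a b v \<gamma> :: real
  assumes "0 < a" and "a \<le> v" and "v \<le> b"
  shows "v powr \<gamma> \<le> max (a powr \<gamma>) (b powr \<gamma>)"
proof (cases "0 \<le> \<gamma>")
  case True
  then have "v powr \<gamma> \<le> b powr \<gamma>" using assms by (intro powr_mono2) auto
  then show ?thesis by simp
next
  case False
  then have "v powr \<gamma> \<le> a powr \<gamma>" using assms by (intro powr_mono2') auto
  then show ?thesis by simp
qed

text \<open>If every step were smaller than the corresponding term of the geometric series with total
  \<open>\<bar>a 0\<bar>\<close>, the steps could not lead from \<open>a 0\<close> to \<open>0\<close>.\<close>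

lemma telescoping_geometric_step:
  fixes a :: "nat \<Rightarrow> real"
  assumes "a N = 0" and q: "0 < q" "q < 1"
  obtains k where "\<bar>a 0\<bar> * (1 - q) * q ^ k \<le> \<bar>a k - a (Suc k)\<bar>"
proof (rule ccontr)
  assume "\<not> thesis"
  with that have small: "\<bar>a k - a (Suc k)\<bar> < \<bar>a 0\<bar> * (1 - q) * q ^ k" for k
    by (meson not_le)
  have "a 0 \<noteq> 0"
    using small[of 0] by auto
  then have "N > 0"
    using \<open>a N = 0\<close> by (cases N) auto
  have "\<bar>a 0\<bar> = \<bar>\<Sum>k<N. a k - a (Suc k)\<bar>"
    using \<open>a N = 0\<close> by (simp add: sum_lessThan_telescope')
  also have "\<dots> \<le> (\<Sum>k<N. \<bar>a k - a (Suc k)\<bar>)"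
    by (rule sum_abs)
  also have "\<dots> < (\<Sum>k<N. \<bar>a 0\<bar> * (1 - q) * q ^ k)"
    using small \<open>N > 0\<close> by (intro sum_strict_mono) auto
  also have "\<dots> = \<bar>a 0\<bar> * (1 - q ^ N)"
    using q by (simp add: sum_distrib_left[symmetric] sum_gp_strict)
  also have "\<dots> \<le> \<bar>a 0\<bar>"
    using q by (simp add: mult_left_le)
  finally show False by simp
qed

section \<open>Points chosen by averages\<close>

text \<open>Markov's inequality for the level of three times the average, multiplied out so that it
  also holds when the integral is \<open>0\<close> or \<open>\<infinity>\<close>.\<close>

lemma emeasure_above_three_averages:
  fixes f :: "'a \<Rightarrow> ennreal"
  assumes f[measurable]: "f \<in> borel_measurable M" and B[measurable]: "B \<in> sets M"
  shows "3 * emeasure M {x\<in>B. 3 * (\<integral>\<^sup>+x\<in>B. f x \<partial>M) < f x * emeasure M B} \<le> emeasure M B"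
proof -
  define I where "I = (\<integral>\<^sup>+x\<in>B. f x \<partial>M)"
  define m where "m = emeasure M B"
  define P where "P = {x\<in>B. 3 * I < f x * m}"
  have BM: "B \<subseteq> space M" by (rule sets.sets_into_space[OF B])
  have P_eq: "P = {x\<in>space M. x \<in> B \<and> 3 * I < f x * m}"
    using BM by (auto simp: P_def)
  have P[measurable]: "P \<in> sets M"
    unfolding P_eq by measurable
  consider "I = 0" | "I = \<infinity>" | "0 < I" "I < \<infinity>"
    by (metis ennreal_zero_less_top gr_zeroI infinity_ennreal_def top.not_eq_extremum)
  then have "3 * emeasure M P \<le> m"
  proof cases
    case 1
    then have "AE x in M. f x * indicator B x = 0"
      unfolding I_def by (subst (asm) nn_integral_0_iff_AE) auto
    then have "AE x in M. x \<notin> P"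
      by eventually_elim (auto simp: P_def indicator_def split: if_splits)
    then have "emeasure M P = 0"
      using P_eq by (subst AE_iff_measurable[symmetric, where P="\<lambda>x. x \<notin> P"]) (auto simp: P_def)
    then show ?thesis by simp
  next
    case 2
    then have "P = {}" by (auto simp: P_def ennreal_mult_top)
    then show ?thesis by simp
  next
    case 3
    have "(3 * emeasure M P) * I = (\<integral>\<^sup>+x. 3 * I * indicator P x \<partial>M)"
      by (subst nn_integral_cmult_indicator) (auto simp: ac_simps)
    also have "\<dots> \<le> (\<integral>\<^sup>+x. (f x * indicator B x) * m \<partial>M)"
      by (intro nn_integral_mono) (auto simp: P_def indicator_def)
    also have "\<dots> = m * I"
      by (subst nn_integral_multc) (auto simp: I_def mult.commute)
    finally show ?thesis
      using 3 by (metis ennreal_mult_le_mult_iff infinity_ennreal_def mult.commute not_gr_zero order_less_irrefl)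
  qed
  then show ?thesis by (simp add: P_def I_def m_def)
qed

text \<open>Each of the two exceptional sets takes up at most a third of \<open>B\<close>, so together they do not
  exhaust it.\<close>

lemma exists_point_below_three_averages:
  fixes f g :: "'a \<Rightarrow> ennreal"
  assumes [measurable]: "f \<in> borel_measurable M" "g \<in> borel_measurable M" "B \<in> sets M"
    and B: "0 < emeasure M B" "emeasure M B < \<infinity>"
  obtains y where "y \<in> B" "f y * emeasure M B \<le> 3 * (\<integral>\<^sup>+x\<in>B. f x \<partial>M)"
    "g y * emeasure M B \<le> 3 * (\<integral>\<^sup>+x\<in>B. g x \<partial>M)"
proof -
  define bad where "bad h = {x\<in>B. 3 * (\<integral>\<^sup>+x\<in>B. h x \<partial>M) < h x * emeasure M B}"
    for h :: "'a \<Rightarrow> ennreal"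
  have BM: "B \<subseteq> space M" by (rule sets.sets_into_space) measurable
  have bad_meas: "bad h \<in> sets M" if [measurable]: "h \<in> borel_measurable M" for h
  proof -
    have "bad h = {x\<in>space M. x \<in> B \<and> 3 * (\<integral>\<^sup>+x\<in>B. h x \<partial>M) < h x * emeasure M B}"
      using BM by (auto simp: bad_def)
    then show ?thesis by simp
  qed
  have "\<not> B \<subseteq> bad f \<union> bad g"
  proof
    assume sub: "B \<subseteq> bad f \<union> bad g"
    have "3 * emeasure M B \<le> 3 * (emeasure M (bad f) + emeasure M (bad g))"
      using sub bad_meas
      by (intro mult_left_mono order_trans[OF emeasure_mono emeasure_subadditive]) auto
    also have "\<dots> \<le> emeasure M B + emeasure M B"
      unfolding distrib_left bad_def
      using B by (intro add_mono emeasure_above_three_averages) auto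
    finally show False
      using B by (cases "emeasure M B") (auto simp: ennreal_mult[symmetric] ennreal_plus[symmetric] ennreal_less_zero_iff
        simp flip: ennreal_numeral simp del: ennreal_plus ennreal_numeral)
  qed
  then obtain y where "y \<in> B" "y \<notin> bad f" "y \<notin> bad g"
    by blast
  then show thesis
    by (intro that[of y]) (simp_all add: bad_def not_less)
qed

section \<open>Covers, disjoint families and integrals over cones\<close>

text \<open>The content is defined with covers indexed by natural numbers; covering arguments produce
  countable families with other index sets, and bounds for finite partial sums.\<close>

lemma hausdorff_content_le_countable_cover:
  fixes x :: "'i \<Rightarrow> 'a::euclidean_space"
  assumes "countable C" and pos: "\<And>j. j \<in> C \<Longrightarrow> 0 < r j"
    and cover: "E \<subseteq> (\<Union>j\<in>C. ball (x j) (r j))"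
    and sums: "\<And>F. finite F \<Longrightarrow> F \<subseteq> C \<Longrightarrow> (\<Sum>j\<in>F. ennreal (r j powr lam)) \<le> M"
  shows "hausdorff_content lam E \<le> M"
proof -
  define h where "h = from_nat_into C"
  define I where "I = to_nat_on C ` C"
  have h: "h (to_nat_on C j) = j" if "j \<in> C" for j
    using \<open>countable C\<close> that by (simp add: h_def)
  have inj: "inj_on (to_nat_on C) C"
    using \<open>countable C\<close> by (rule inj_on_to_nat_on)
  have "hausdorff_content lam E \<le> (\<Sum>\<^sub>\<infinity>i\<in>I. ennreal (r (h i) powr lam))"
    unfolding hausdorff_content_def
  proof (rule Inf_lower, rule CollectI, intro exI conjI)
    show "\<forall>i\<in>I. 0 < r (h i)" using pos h by (auto simp: I_def)
    show "E \<subseteq> (\<Union>i\<in>I. ball (x (h i)) (r (h i)))"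
      using cover h by (fastforce simp: I_def)
  qed simp
  also have "\<dots> = (\<Sum>\<^sub>\<infinity>j\<in>C. ennreal (r j powr lam))"
    unfolding I_def infsum_reindex[OF inj] by (rule infsum_cong) (simp add: h)
  also have "\<dots> \<le> M"
    by (subst nonneg_infsum_complete) (simp, rule SUP_least, use sums in blast)
  finally show ?thesis .
qed

lemma sum_nn_integral_disjoint_le:
  fixes f :: "'a \<Rightarrow> ennreal"
  assumes "finite F" and [measurable]: "f \<in> borel_measurable M"
    and [measurable]: "\<And>j. j \<in> F \<Longrightarrow> B j \<in> sets M"
    and disj: "disjoint_family_on B F" and sub: "\<And>j. j \<in> F \<Longrightarrow> B j \<subseteq> A"
  shows "(\<Sum>j\<in>F. \<integral>\<^sup>+x\<in>B j. f x \<partial>M) \<le> (\<integral>\<^sup>+x\<in>A. f x \<partial>M)"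
proof -
  have "(\<Sum>j\<in>F. \<integral>\<^sup>+x\<in>B j. f x \<partial>M) = (\<integral>\<^sup>+x. (\<Sum>j\<in>F. f x * indicator (B j) x) \<partial>M)"
    by (subst nn_integral_sum) auto
  also have "\<dots> \<le> (\<integral>\<^sup>+x\<in>A. f x \<partial>M)"
  proof (rule nn_integral_mono)
    fix x
    have "(\<Sum>j\<in>F. f x * indicator (B j) x) = f x * indicator (\<Union>j\<in>F. B j) x"
      using disj \<open>finite F\<close> by (simp add: sum_distrib_left[symmetric] indicator_UN_disjoint)
    also have "\<dots> \<le> f x * indicator A x"
      using sub by (intro mult_left_mono) (auto simp: indicator_def)
    finally show "(\<Sum>j\<in>F. f x * indicator (B j) x) \<le> f x * indicator A x" .
  qed
  finally show ?thesis .
qed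

text \<open>The set \<open>A\<close> is part of a cone over \<open>y\<close>, on which \<open>\<delta>\<close> is at least a quarter of the distance to
  \<open>y\<close>. The layer where \<open>\<delta>\<close> lies between \<open>t = \<rho> 2\<^sup>j\<close> and \<open>2 t\<close> is contained in a ball of radius \<open>8 t\<close>, so
  it contributes at most a constant times \<open>t\<close> to the power \<open>- \<eta>\<close>; these contributions form a convergent
  geometric series.\<close>

lemma nn_integral_cone_le:
  fixes y :: "'a::euclidean_space" and \<delta> :: "'a \<Rightarrow> real"
  assumes [measurable]: "\<delta> \<in> borel_measurable borel" "A \<in> sets borel"
    and "0 < \<eta>" and "0 < \<rho>"
    and near: "\<And>x. x \<in> A \<Longrightarrow> dist x y \<le> 4 * \<delta> x" and far: "\<And>x. x \<in> A \<Longrightarrow> \<rho> \<le> \<delta> x"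
  shows "(\<integral>\<^sup>+x\<in>A. ennreal (\<delta> x powr (- real DIM('a) - \<eta>)) \<partial>lborel)
    \<le> ennreal (unit_ball_vol DIM('a) * 8 ^ DIM('a) / (1 - 2 powr - \<eta>) * \<rho> powr - \<eta>)"
proof -
  define n where "n = DIM('a)"
  define t where "t j = \<rho> * 2 powr real j" for j :: nat
  have t_pos: "0 < t j" for j using \<open>0 < \<rho>\<close> by (simp add: t_def)
  define h :: "nat \<Rightarrow> 'a \<Rightarrow> ennreal"
    where "h = (\<lambda>j x. ennreal (t j powr (- real n - \<eta>)) * indicator (cball y (8 * t j)) x)"
  have h_meas: "h j \<in> borel_measurable lborel" for j
    unfolding h_def by (intro borel_measurable_times_ennreal borel_measurable_indicator) auto
  have pw: "ennreal (\<delta> x powr (- real n - \<eta>)) * indicator A x \<le> (\<Sum>j. h j x)" for x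
  proof (cases "x \<in> A")
    case True
    \<comment> \<open>The index of the layer that contains \<open>x\<close>.\<close>
    define j where "j = nat \<lfloor>log 2 (\<delta> x / \<rho>)\<rfloor>"
    have d: "\<rho> \<le> \<delta> x" "dist x y \<le> 4 * \<delta> x" using near far True by auto
    have l0: "0 \<le> log 2 (\<delta> x / \<rho>)" using d \<open>0 < \<rho>\<close> by simp
    then have j: "real j \<le> log 2 (\<delta> x / \<rho>)" "log 2 (\<delta> x / \<rho>) < real j + 1"
      by (auto simp: j_def)
    have pos: "0 < \<delta> x / \<rho>" using d \<open>0 < \<rho>\<close> by simp
    have "2 powr real j \<le> \<delta> x / \<rho>"
      using j(1) pos by (simp add: le_log_iff)
    then have lo: "t j \<le> \<delta> x"
      using \<open>0 < \<rho>\<close> by (simp add: t_def field_simps)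
    have "\<delta> x / \<rho> < 2 powr (real j + 1)"
      using j(2) pos by (simp add: log_less_iff)
    then have hi: "\<delta> x < 2 * t j"
      using \<open>0 < \<rho>\<close> by (simp add: t_def field_simps powr_add)
    have "ennreal (\<delta> x powr (- real n - \<eta>)) \<le> h j x"
      using d(2) hi lo t_pos \<open>0 < \<eta>\<close>
      by (auto simp: h_def indicator_def dist_commute intro!: ennreal_leI powr_mono2')
    also have "\<dots> = (\<Sum>j\<in>{j}. h j x)" by simp
    also have "\<dots> \<le> (\<Sum>j. h j x)" by (intro sum_le_suminf) auto
    finally show ?thesis using True by simp
  qed simp
  define c where "c = unit_ball_vol n * 8 ^ n * \<rho> powr - \<eta>"
  have c0: "0 \<le> c" by (simp add: c_def)
  have ratio: "\<bar>2 powr - \<eta>\<bar> < 1"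
    using powr_less_mono[of "- \<eta>" 0 2] \<open>0 < \<eta>\<close> by simp
  have "(\<integral>\<^sup>+x\<in>A. ennreal (\<delta> x powr (- real n - \<eta>)) \<partial>lborel) \<le> (\<integral>\<^sup>+x. (\<Sum>j. h j x) \<partial>lborel)"
    by (intro nn_integral_mono pw)
  also have "\<dots> = (\<Sum>j. \<integral>\<^sup>+x. h j x \<partial>lborel)"
    by (rule nn_integral_suminf) (rule h_meas)
  also have "\<dots> = (\<Sum>j. ennreal (c * (2 powr - \<eta>) ^ j))"
  proof (rule suminf_cong)
    fix j
    have "(\<integral>\<^sup>+x. h j x \<partial>lborel) = ennreal (t j powr (- real n - \<eta>) * (unit_ball_vol n * (8 * t j) ^ n))"
      unfolding h_def using t_pos[of j]
      by (subst nn_integral_cmult_indicator) (auto simp: emeasure_cball n_def ennreal_mult')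
    also have "t j powr (- real n - \<eta>) * (unit_ball_vol n * (8 * t j) ^ n)
        = unit_ball_vol n * 8 ^ n * t j powr - \<eta>"
    proof -
      have "t j powr (- real n - \<eta>) = t j powr (- \<eta> - real n)"
        by (subst minus_diff_commute) (rule refl)
      also have "\<dots> = t j powr - \<eta> / t j ^ n"
        using t_pos[of j] by (simp only: powr_diff powr_realpow)
      finally show ?thesis
        using t_pos[of j] by (simp add: power_mult_distrib)
    qed
    also have "t j powr - \<eta> = \<rho> powr - \<eta> * (2 powr - \<eta>) ^ j"
      using \<open>0 < \<rho>\<close> by (simp add: t_def powr_mult powr_powr mult.commute flip: powr_realpow)
    finally show "(\<integral>\<^sup>+x. h j x \<partial>lborel) = ennreal (c * (2 powr - \<eta>) ^ j)"
      by (simp add: c_def mult_ac)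
  qed
  also have "\<dots> = ennreal (\<Sum>j. c * (2 powr - \<eta>) ^ j)"
    using c0 ratio by (intro suminf_ennreal2) (auto intro!: summable_mult summable_geometric)
  also have "(\<Sum>j. c * (2 powr - \<eta>) ^ j) = c / (1 - 2 powr - \<eta>)"
    using ratio by (subst suminf_mult) (auto simp: suminf_geometric intro!: summable_geometric)
  finally show ?thesis by (simp add: c_def n_def field_simps)
qed

section \<open>The distance to the complement\<close>

lemma bdist_measurable [measurable]:
  "bdist (D :: 'a::euclidean_space set) \<in> borel_measurable borel"
  by (intro borel_measurable_continuous_onI continuous_intros)

lemma bdist_pos:
  fixes D :: "'a::euclidean_space set"
  assumes "open D" and "D \<noteq> UNIV" and "x \<in> D"
  shows "0 < bdist D x"
  using assms by (intro infdist_pos_not_in_closed) (auto simp: closed_Compl)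

lemma frontier_imp_not_mem:
  assumes "open D" and "z \<in> frontier D"
  shows "z \<notin> D"
  using assms by (auto simp: frontier_def interior_open)

lemma bdist_le_dist_frontier:
  fixes D :: "'a::euclidean_space set"
  assumes "open D" and "z \<in> frontier D"
  shows "bdist D x \<le> dist x z"
  using frontier_imp_not_mem[OF assms] by (intro infdist_le) simp

text \<open>Plumpness provides balls inside \<open>D\<close>; away from their boundary the distance to the complement
  is comparable to their radius.\<close>

lemma bdist_ge_half_radius:
  fixes D :: "'a::euclidean_space set"
  assumes "ball w \<rho> \<subseteq> D" and "D \<noteq> UNIV" and "v \<in> ball w (\<rho> / 2)"
  shows "\<rho> / 2 \<le> bdist D v"
proof -
  have "\<rho> / 2 \<le> dist v c" if "c \<in> - D" for c
  proof -
    have "\<rho> \<le> dist w c"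
      using that assms(1) by (meson ComplD mem_ball not_le subsetD)
    also have "\<dots> \<le> dist w v + dist v c" by (rule dist_triangle)
    finally show ?thesis using assms(3) by simp
  qed
  moreover have ne: "- D \<noteq> {}" using assms(2) by auto
  ultimately have "\<rho> / 2 \<le> (INF c\<in>- D. dist v c)"
    by (intro cINF_greatest)
  with ne show ?thesis by (simp add: infdist_notempty)
qed

text \<open>Ensures that plumpness applies at all scales up to the distance to the complement.\<close>

lemma bdist_less_ediam:
  fixes D :: "'a::euclidean_space set"
  assumes "0 < bdist D x"
  shows "ennreal (bdist D x) < ediam D"
proof -
  obtain e :: 'a where "e \<in> Basis" by (meson ex_in_conv nonempty_Basis)
  then have e: "norm e = 1" by simp
  \<comment> \<open>Two opposite points of the inscribed ball, whose distance is three halves of its radius;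
    any factor strictly between \<open>1 / 2\<close> and \<open>1\<close> would do here.\<close>
  define r where "r = 3 / 4 * bdist D x"
  have ins: "y \<in> D" if "dist x y < bdist D x" for y
    using infdist_le[of y "- D" x] that by force
  have mem: "x + r *\<^sub>R e \<in> D" "x - r *\<^sub>R e \<in> D"
    using e assms by (auto intro!: ins simp: dist_norm r_def)
  have "(x + r *\<^sub>R e) - (x - r *\<^sub>R e) = (2 * r) *\<^sub>R e" by (simp flip: scaleR_add_left)
  then have "dist (x + r *\<^sub>R e) (x - r *\<^sub>R e) = 2 * r"
    using e assms by (simp add: dist_norm r_def)
  moreover have "ennreal (dist (x + r *\<^sub>R e) (x - r *\<^sub>R e)) \<le> ediam D"
    unfolding ediam_def using mem by (meson SUP_upper2 order_refl)
  moreover have "ennreal (bdist D x) < ennreal (2 * r)"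
    using assms by (intro ennreal_lessI) (auto simp: r_def)
  ultimately show ?thesis by simp
qed

text \<open>Two opposite rays from \<open>x\<close> must both leave the bounded set \<open>D\<close>, and their exit points are at
  least \<open>2 \<delta>(x)\<close> apart. Hence local fatness of the boundary applies at radius \<open>\<delta>(x)\<close>.\<close>

lemma twice_bdist_le_ediam_frontier:
  fixes D :: "'a::euclidean_space set"
  assumes "open D" and "bounded D" and "x \<in> D"
  shows "ennreal (2 * bdist D x) \<le> ediam (frontier D)"
proof -
  obtain e :: 'a where e: "e \<in> Basis" by (meson ex_in_conv nonempty_Basis)
  have hit: "\<exists>t\<ge>0. x + t *\<^sub>R v \<in> frontier D" if "norm v = 1" for v :: 'a
  proof -
    define S where "S = (\<lambda>t. x + t *\<^sub>R v) ` {0..}"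
    have "connected S"
      unfolding S_def by (intro connected_continuous_image continuous_intros) auto
    moreover have "S \<inter> D \<noteq> {}"
      using \<open>x \<in> D\<close> by (auto simp: S_def image_iff intro!: bexI[of _ 0])
    moreover have "S - D \<noteq> {}"
    proof
      assume "S - D = {}"
      then have "bounded S" using \<open>bounded D\<close> by (auto intro: bounded_subset)
      then obtain b where b: "\<And>y. y \<in> S \<Longrightarrow> dist x y \<le> b"
        by (meson bounded_any_center)
      have "dist x (x + (\<bar>b\<bar> + 1) *\<^sub>R v) \<le> b"
        by (rule b) (auto simp: S_def)
      then show False using that by (simp add: dist_norm)
    qed
    ultimately have "S \<inter> frontier D \<noteq> {}"
      by (rule connected_Int_frontier)
    then show ?thesis by (auto simp: S_def)
  qed
  have ne: "norm e = 1" "norm (- e) = 1" using e by auto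
  obtain t where t: "0 \<le> t" "x + t *\<^sub>R e \<in> frontier D" using hit[OF ne(1)] by auto
  obtain t' where t': "0 \<le> t'" "x + t' *\<^sub>R - e \<in> frontier D" using hit[OF ne(2)] by auto
  have fr: "frontier D \<subseteq> - D"
    using \<open>open D\<close> by (auto simp: frontier_def interior_open)
  have "bdist D x \<le> t" using infdist_le[of "x + t *\<^sub>R e" "- D" x] t fr e by (auto simp: dist_norm)
  moreover have "bdist D x \<le> t'"
    using infdist_le[of "x + t' *\<^sub>R - e" "- D" x] t' fr e by (auto simp: dist_norm)
  moreover have "dist (x + t *\<^sub>R e) (x + t' *\<^sub>R - e) = t + t'"
  proof -
    have "(x + t *\<^sub>R e) - (x + t' *\<^sub>R - e) = (t + t') *\<^sub>R e" by (simp add: algebra_simps)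
    then show ?thesis using t t' ne by (simp add: dist_norm)
  qed
  ultimately have "ennreal (2 * bdist D x) \<le> ennreal (dist (x + t *\<^sub>R e) (x + t' *\<^sub>R - e))"
    by (intro ennreal_leI) simp
  also have "\<dots> \<le> ediam (frontier D)"
    unfolding ediam_def using t t' by (meson SUP_upper2 order_refl)
  finally show ?thesis .
qed

section \<open>Differences of function values and the energy density\<close>

definition energy_kernel ::
    "real \<Rightarrow> real \<Rightarrow> real \<Rightarrow> 'a::euclidean_space set \<Rightarrow> ('a \<Rightarrow> real) \<Rightarrow> 'a \<Rightarrow> 'a \<Rightarrow> real" where
  "energy_kernel s p \<beta> D u x y =
     \<bar>u x - u y\<bar> powr p / dist x y powr (real DIM('a) + s * p) * bdist D x powr \<beta>"

definition energy_density ::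
    "real \<Rightarrow> real \<Rightarrow> real \<Rightarrow> 'a::euclidean_space set \<Rightarrow> ('a \<Rightarrow> real) \<Rightarrow> 'a \<Rightarrow> ennreal" where
  "energy_density s p \<beta> D u x = (\<integral>\<^sup>+y\<in>D. ennreal (energy_kernel s p \<beta> D u x y) \<partial>lborel)"

lemma energy_density_measurable:
  fixes u :: "'a::euclidean_space \<Rightarrow> real"
  assumes "continuous_on UNIV u" and "open D"
  shows "energy_density s p \<beta> D u \<in> borel_measurable borel"
proof -
  have [measurable]: "u \<in> borel_measurable borel" "D \<in> sets borel"
    using assms by (auto intro: borel_measurable_continuous_onI)
  have "(\<lambda>x. \<integral>\<^sup>+y\<in>D. ennreal (energy_kernel s p \<beta> D u x y) \<partial>lborel) \<in> borel_measurable borel"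
    unfolding energy_kernel_def by measurable
  then show ?thesis
    unfolding energy_density_def[abs_def] by simp
qed

text \<open>The weight and the kernel are replaced by powers of the scale \<open>t\<close>: the power of the distance is
  monotone because its exponent \<open>d + s p\<close> is nonnegative, while the weight exponent \<open>\<beta>\<close> may have either
  sign, hence the maximum over both ends of the range of \<open>\<delta>(x) / t\<close>.\<close>

lemma difference_le_energy_kernel:
  fixes u :: "'a::euclidean_space \<Rightarrow> real"
  assumes "0 \<le> real DIM('a) + s * p" and "0 < \<kappa>" and "0 < t"
    and \<delta>: "\<kappa> / 2 * t \<le> bdist D x" "bdist D x \<le> 2 * t" and xy: "dist x y \<le> 3 * t"
  shows "\<bar>u x - u y\<bar> powr p \<le>
    3 powr (real DIM('a) + s * p) * max ((\<kappa> / 2) powr - \<beta>) (2 powr - \<beta>) *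
    t powr (real DIM('a) + s * p - \<beta>) * energy_kernel s p \<beta> D u x y"
proof (cases "x = y")
  case True
  then show ?thesis by (simp add: energy_kernel_def)
next
  case False
  define a where "a = real DIM('a) + s * p"
  define m where "m = max ((\<kappa> / 2) powr - \<beta>) (2 powr - \<beta>)"
  define X where "X = \<bar>u x - u y\<bar> powr p"
  define \<delta> where "\<delta> = bdist D x"
  have "0 < \<kappa> / 2 * t" using assms by simp
  then have d0: "0 < \<delta>" using \<delta>(1) by (simp add: \<delta>_def)
  have "(\<delta> / t) powr - \<beta> \<le> m"
    unfolding m_def using assms by (intro powr_le_max_endpoints) (auto simp: \<delta>_def field_simps)
  then have "\<delta> powr - \<beta> / t powr - \<beta> \<le> m"
    using d0 \<open>0 < t\<close> by (simp add: powr_divide)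
  then have "1 \<le> m * t powr - \<beta> * \<delta> powr \<beta>"
    using d0 \<open>0 < t\<close> by (simp add: powr_minus field_simps)
  moreover have "dist x y powr a \<le> (3 * t) powr a"
    using xy assms(1) by (intro powr_mono2) (auto simp: a_def)
  ultimately have "dist x y powr a * 1 \<le> (3 * t) powr a * (m * t powr - \<beta> * \<delta> powr \<beta>)"
    by (intro mult_mono) (auto simp: m_def le_max_iff_disj)
  then have "X * 1 \<le> X * ((3 * t) powr a * (m * t powr - \<beta> * \<delta> powr \<beta>) / dist x y powr a)"
    using False by (intro mult_left_mono) (auto simp: X_def field_simps)
  also have "(3 * t) powr a = 3 powr a * t powr a"
    using \<open>0 < t\<close> by (simp add: powr_mult)
  also have "X * (3 powr a * t powr a * (m * t powr - \<beta> * \<delta> powr \<beta>) / dist x y powr a)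
    = 3 powr a * m * (t powr a * t powr - \<beta>) * (X / dist x y powr a * \<delta> powr \<beta>)"
    by (simp add: field_simps)
  also have "t powr a * t powr - \<beta> = t powr (a - \<beta>)"
    by (simp flip: powr_add)
  finally show ?thesis
    by (simp add: X_def \<delta>_def m_def a_def energy_kernel_def)
qed

text \<open>The factor in one step of a chain: \<open>3\<close> from the choice of a point by averages, then the constant
  of the kernel bound, divided by the volume of a ball of radius \<open>\<kappa> / 4\<close>. The factors that depend on the
  scale \<open>t\<close> combine to \<open>t\<close> to the power \<open>s p - \<beta>\<close>.\<close>

definition step_const :: "real \<Rightarrow> real \<Rightarrow> real \<Rightarrow> real \<Rightarrow> 'a::euclidean_space itself \<Rightarrow> real" where
  "step_const \<kappa> s p \<beta> T =
     3 * (3 powr (real DIM('a) + s * p) * max ((\<kappa> / 2) powr - \<beta>) (2 powr - \<beta>))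
       / (unit_ball_vol DIM('a) * (\<kappa> / 4) ^ DIM('a))"

lemma step_const_pos: "0 < \<kappa> \<Longrightarrow> 0 < step_const \<kappa> s p \<beta> TYPE('a::euclidean_space)"
  unfolding step_const_def
  by (intro divide_pos_pos mult_pos_pos zero_less_power) (auto simp: less_max_iff_disj)

text \<open>The value of \<open>u\<close> at \<open>v\<close> is compared with the values on a whole ball in \<open>D\<close>, and the kernel bound
  is integrated over that ball.\<close>

lemma difference_le_energy_density:
  fixes u :: "'a::euclidean_space \<Rightarrow> real"
  assumes "0 \<le> real DIM('a) + s * p" and "0 < \<kappa>" and "0 < t"
    and \<delta>: "\<kappa> / 2 * t \<le> bdist D x" "bdist D x \<le> 2 * t"
    and B: "ball w (\<kappa> * t / 4) \<subseteq> D" and xB: "\<And>y. y \<in> ball w (\<kappa> * t / 4) \<Longrightarrow> dist x y \<le> 3 * t"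
    and u: "continuous_on UNIV u" and D: "open D"
    and avg: "ennreal (\<bar>u x - u v\<bar> powr p) * emeasure lborel (ball w (\<kappa> * t / 4)) \<le>
      3 * (\<integral>\<^sup>+y\<in>ball w (\<kappa> * t / 4). ennreal (\<bar>u x - u y\<bar> powr p) \<partial>lborel)"
  shows "ennreal (\<bar>u x - u v\<bar> powr p) \<le>
    ennreal (step_const \<kappa> s p \<beta> TYPE('a) * t powr (s * p - \<beta>)) * energy_density s p \<beta> D u x"
proof -
  define n where "n = DIM('a)"
  define a where "a = real n + s * p"
  define m where "m = max ((\<kappa> / 2) powr - \<beta>) (2 powr - \<beta>)"
  define c where "c = 3 powr a * m * t powr (a - \<beta>)"
  define B where "B = ball w (\<kappa> * t / 4)"
  have c0: "0 \<le> c" by (simp add: c_def m_def le_max_iff_disj)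
  have [measurable]: "u \<in> borel_measurable borel" "D \<in> sets borel"
    using u D by (auto intro: borel_measurable_continuous_onI)
  have "(\<integral>\<^sup>+y\<in>B. ennreal (\<bar>u x - u y\<bar> powr p) \<partial>lborel)
      \<le> (\<integral>\<^sup>+y. ennreal c * (ennreal (energy_kernel s p \<beta> D u x y) * indicator D y) \<partial>lborel)"
  proof (rule nn_integral_mono)
    fix y
    show "ennreal (\<bar>u x - u y\<bar> powr p) * indicator B y
        \<le> ennreal c * (ennreal (energy_kernel s p \<beta> D u x y) * indicator D y)"
    proof (cases "y \<in> B")
      case True
      then have "\<bar>u x - u y\<bar> powr p \<le> c * energy_kernel s p \<beta> D u x y"
        unfolding c_def m_def a_def n_def
        using assms(1-5) xB by (intro difference_le_energy_kernel) (auto simp: B_def)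
      moreover have "y \<in> D" using True assms(6) by (auto simp: B_def)
      ultimately show ?thesis
        using True c0 by (simp add: ennreal_leI flip: ennreal_mult')
    qed simp
  qed
  also have "\<dots> = ennreal c * energy_density s p \<beta> D u x"
    unfolding energy_density_def energy_kernel_def by (rule nn_integral_cmult) measurable
  finally have "3 * (\<integral>\<^sup>+y\<in>B. ennreal (\<bar>u x - u y\<bar> powr p) \<partial>lborel)
      \<le> 3 * (ennreal c * energy_density s p \<beta> D u x)"
    by (rule mult_left_mono) simp
  also have "\<dots> = ennreal (3 * c) * energy_density s p \<beta> D u x"
    using c0 by (simp add: ennreal_mult mult.assoc)
  finally have "ennreal (\<bar>u x - u v\<bar> powr p) * emeasure lborel B
      \<le> ennreal (3 * c) * energy_density s p \<beta> D u x"
    using avg by (simp add: B_def)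
  moreover have "emeasure lborel B = ennreal (unit_ball_vol n * (\<kappa> * t / 4) ^ n)"
    unfolding B_def n_def using assms by (intro emeasure_ball) auto
  ultimately have "ennreal (\<bar>u x - u v\<bar> powr p) * ennreal (unit_ball_vol n * (\<kappa> * t / 4) ^ n)
      \<le> ennreal (3 * c) * energy_density s p \<beta> D u x"
    by simp
  then have "ennreal (\<bar>u x - u v\<bar> powr p)
      \<le> ennreal (3 * c / (unit_ball_vol n * (\<kappa> * t / 4) ^ n)) * energy_density s p \<beta> D u x"
    using assms c0 by (intro le_ennreal_divideI) auto
  moreover have "3 * c / (unit_ball_vol n * (\<kappa> * t / 4) ^ n)
      = step_const \<kappa> s p \<beta> TYPE('a) * t powr (s * p - \<beta>)"
  proof -
    have "t powr (a - \<beta>) = t ^ n * t powr (s * p - \<beta>)"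
      using \<open>0 < t\<close> by (simp add: a_def add_diff_eq powr_add[symmetric] powr_realpow[symmetric])
    moreover have "(\<kappa> * t / 4) ^ n = (\<kappa> / 4) ^ n * t ^ n"
      by (simp add: power_mult_distrib[symmetric])
    ultimately show ?thesis
      using \<open>0 < t\<close> by (simp add: step_const_def c_def m_def a_def n_def)
  qed
  ultimately show ?thesis by simp
qed

section \<open>Chains of plump balls\<close>

text \<open>Two demands are made on each new point of the chain, and both are met at points where two functions
  are at most three times their averages over the next ball: the value of \<open>u\<close> there must be close to the previous value, which
  bounds the step, and the energy density must be small, so that the next step, which is bounded by that
  density, is bounded by an integral. Choosing points instead of averaging \<open>u\<close> keeps all
  estimates meaningful when the density is infinite.\<close>

lemma plump_chain:
  fixes u :: "'a::euclidean_space \<Rightarrow> real"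
  assumes dsp: "0 \<le> real DIM('a) + s * p" and \<kappa>: "0 < \<kappa>" "\<kappa> < 1"
    and D: "open D" "D \<noteq> UNIV" "plump \<kappa> D"
    and u: "continuous_on UNIV u"
    and x: "x \<in> D" and z: "z \<in> frontier D" "dist x z \<le> 2 * bdist D x" "z \<notin> closure {x. u x \<noteq> 0}"
  defines "r \<equiv> \<lambda>k. bdist D x / 2 ^ k"
  obtains y w N where "y 0 = x" and "u (y N) = 0"
    and "\<And>k. ball (w k) (\<kappa> * r k) \<subseteq> D" and "\<And>k. w k \<in> cball z (r k)"
    and "\<And>k. ennreal (\<bar>u (y k) - u (y (Suc k))\<bar> powr p) \<le>
      ennreal (step_const \<kappa> s p \<beta> TYPE('a) * r k powr (s * p - \<beta>)) * energy_density s p \<beta> D u (y k)"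
    and "\<And>k. 0 < k \<Longrightarrow> energy_density s p \<beta> D u (y k) * emeasure lborel (ball (w k) (\<kappa> * r k / 2)) \<le>
      3 * (\<integral>\<^sup>+v\<in>ball (w k) (\<kappa> * r k / 2). energy_density s p \<beta> D u v \<partial>lborel)"
proof -
  let ?G = "energy_density s p \<beta> D u"
  have G[measurable]: "?G \<in> borel_measurable borel"
    by (rule energy_density_measurable[OF u D(1)])
  have [measurable]: "u \<in> borel_measurable borel"
    using u by (rule borel_measurable_continuous_onI)
  have d0: "0 < bdist D x" using D x by (intro bdist_pos)
  have r0: "0 < r k" for k using d0 by (simp add: r_def)
  have r_Suc: "r (Suc k) = r k / 2" for k by (simp add: r_def)
  have r_le: "r k \<le> bdist D x" for k
    using d0 by (simp add: r_def divide_le_eq mult_le_cancel_left1)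
  have "\<exists>w. w \<in> cball z (r k) \<and> ball w (\<kappa> * r k) \<subseteq> D" for k
  proof -
    have "ennreal (r k) \<le> ennreal (bdist D x)" by (rule ennreal_leI[OF r_le])
    also have "\<dots> < ediam D" using d0 by (rule bdist_less_ediam)
    finally have "ennreal (r k) < ediam D" .
    moreover have "z \<in> closure D" using z by (simp add: frontier_def)
    ultimately show ?thesis
      using D(3) r0[of k] unfolding plump_def by blast
  qed
  then obtain w where w: "\<And>k. w k \<in> cball z (r k)" and wD: "\<And>k. ball (w k) (\<kappa> * r k) \<subseteq> D"
    by metis
  \<comment> \<open>Half of the radius is given up to keep the distance to the complement comparable to the
    scale on the whole ball.\<close>
  define B where "B k = ball (w k) (\<kappa> * r k / 2)" for k
  have B_meas[measurable]: "B k \<in> sets lborel" for k by (simp add: B_def)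
  have B_em: "0 < emeasure lborel (B k)" "emeasure lborel (B k) < \<infinity>" for k
    unfolding B_def using \<kappa> r0[of k] by (simp_all add: emeasure_ball ennreal_zero_less_mult_iff)
  have B_near: "dist v z \<le> 2 * r k" if "v \<in> B k" for v k
  proof -
    have "dist v z \<le> dist (w k) v + dist z (w k)"
      by (metis add.commute dist_commute dist_triangle)
    also have "\<dots> \<le> \<kappa> * r k / 2 + r k"
      using that w[of k] by (intro add_mono) (auto simp: B_def)
    also have "\<kappa> * r k \<le> 1 * r k"
      using \<kappa> r0[of k] by (intro mult_right_mono) auto
    finally show ?thesis using r0[of k] by simp
  qed
  have B_far: "\<kappa> / 2 * r k \<le> bdist D v" if "v \<in> B k" for v k
    using bdist_ge_half_radius[OF wD D(2), of v k] that by (simp add: B_def)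
  \<comment> \<open>The first point is \<open>x\<close> itself, which need not lie in the ball with index \<open>0\<close>, and no average
    controls the energy density there.\<close>
  define good where "good k v \<longleftrightarrow> (if k = 0 then v = x else v \<in> B k \<and>
    ?G v * emeasure lborel (B k) \<le> 3 * (\<integral>\<^sup>+v\<in>B k. ?G v \<partial>lborel))" for k v
  have good: "dist v z \<le> 2 * r k" "\<kappa> / 2 * r k \<le> bdist D v" if "good k v" for k v
  proof -
    have "\<kappa> / 2 * bdist D x \<le> 1 * bdist D x"
      using \<kappa> d0 by (intro mult_right_mono) auto
    then show "dist v z \<le> 2 * r k" "\<kappa> / 2 * r k \<le> bdist D v"
      using that z(2) B_near[of v k] B_far[of v k] by (auto simp: good_def r_def split: if_splits)
  qed
  have "\<exists>y. \<forall>k. good k (y k) \<and>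
    ennreal (\<bar>u (y k) - u (y (Suc k))\<bar> powr p) * emeasure lborel (B (Suc k))
      \<le> 3 * (\<integral>\<^sup>+v\<in>B (Suc k). ennreal (\<bar>u (y k) - u v\<bar> powr p) \<partial>lborel)"
  proof (rule dependent_nat_choice)
    show "\<exists>v. good 0 v" by (simp add: good_def)
  next
    fix v k
    obtain v' where "v' \<in> B (Suc k)"
      "ennreal (\<bar>u v - u v'\<bar> powr p) * emeasure lborel (B (Suc k))
        \<le> 3 * (\<integral>\<^sup>+v'\<in>B (Suc k). ennreal (\<bar>u v - u v'\<bar> powr p) \<partial>lborel)"
      "?G v' * emeasure lborel (B (Suc k)) \<le> 3 * (\<integral>\<^sup>+v\<in>B (Suc k). ?G v \<partial>lborel)"
    proof (rule exists_point_below_three_averages[where M = lborel and B = "B (Suc k)" and g = ?G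
        and f = "\<lambda>v'. ennreal (\<bar>u v - u v'\<bar> powr p)"])
      show "(\<lambda>v'. ennreal (\<bar>u v - u v'\<bar> powr p)) \<in> borel_measurable lborel"
        by measurable
      show "?G \<in> borel_measurable lborel" by simp
    qed (rule B_meas B_em | assumption)+
    then show "\<exists>v'. good (Suc k) v' \<and>
      ennreal (\<bar>u v - u v'\<bar> powr p) * emeasure lborel (B (Suc k))
        \<le> 3 * (\<integral>\<^sup>+v'\<in>B (Suc k). ennreal (\<bar>u v - u v'\<bar> powr p) \<partial>lborel)"
      by (auto simp: good_def)
  qed
  then obtain y where y: "\<And>k. good k (y k)"
    and step: "\<And>k. ennreal (\<bar>u (y k) - u (y (Suc k))\<bar> powr p) * emeasure lborel (B (Suc k))
      \<le> 3 * (\<integral>\<^sup>+v\<in>B (Suc k). ennreal (\<bar>u (y k) - u v\<bar> powr p) \<partial>lborel)"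
    by blast
  have B_Suc: "B (Suc k) = ball (w (Suc k)) (\<kappa> * r k / 4)" for k
    by (simp add: B_def r_Suc)
  \<comment> \<open>The points converge to \<open>z\<close>, and \<open>u\<close> vanishes in a neighbourhood of \<open>z\<close>.\<close>
  obtain e where e: "0 < e" "ball z e \<inter> {x. u x \<noteq> 0} = {}"
  proof -
    have "open (- closure {x. u x \<noteq> 0})" by (simp add: open_Compl)
    then obtain e where "0 < e" "ball z e \<subseteq> - closure {x. u x \<noteq> 0}"
      using z(3) by (meson ComplI openE)
    then show thesis
      using closure_subset[of "{x. u x \<noteq> 0}"] by (intro that[of e]) blast+
  qed
  obtain N where "bdist D x / e * 2 < 2 ^ N"
    using real_arch_pow[of 2] by auto
  then have "2 * r N < e" using e(1) by (simp add: r_def field_simps)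
  then have "y N \<in> ball z e" using good(1)[OF y[of N]] by (simp add: dist_commute)
  then have yN: "u (y N) = 0" using e(2) by blast
  show thesis
  proof (rule that)
    show "y 0 = x" using y[of 0] by (simp add: good_def)
    show "ball (w k) (\<kappa> * r k) \<subseteq> D" for k by (rule wD)
    show "w k \<in> cball z (r k)" for k by (rule w)
    show "?G (y k) * emeasure lborel (ball (w k) (\<kappa> * r k / 2))
        \<le> 3 * (\<integral>\<^sup>+v\<in>ball (w k) (\<kappa> * r k / 2). ?G v \<partial>lborel)" if "0 < k" for k
      using y[of k] that by (simp add: good_def B_def)
    show "ennreal (\<bar>u (y k) - u (y (Suc k))\<bar> powr p) \<le>
      ennreal (step_const \<kappa> s p \<beta> TYPE('a) * r k powr (s * p - \<beta>)) * ?G (y k)" for k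
    proof (rule difference_le_energy_density[where w = "w (Suc k)"])
      show "bdist D (y k) \<le> 2 * r k"
        using bdist_le_dist_frontier[OF D(1) z(1), of "y k"] good(1)[OF y] by (meson order_trans)
      have "\<kappa> * r k / 4 \<le> \<kappa> * r (Suc k)" using \<kappa> r0[of k] by (simp add: r_Suc)
      then show "ball (w (Suc k)) (\<kappa> * r k / 4) \<subseteq> D"
        using wD[of "Suc k"] by (meson order_trans subset_ball)
      show "dist (y k) v \<le> 3 * r k" if "v \<in> ball (w (Suc k)) (\<kappa> * r k / 4)" for v
      proof -
        have "dist (y k) v \<le> dist (y k) z + dist v z"
          by (rule dist_triangle2)
        also have "\<dots> \<le> 2 * r k + 2 * r (Suc k)"
          using that B_near[of v "Suc k"] good(1)[OF y[of k]] by (intro add_mono) (auto simp: B_Suc)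
        finally show ?thesis by (simp add: r_Suc)
      qed
    qed (use dsp \<kappa> r0 good(2)[OF y[of k]] u D step[of k] in \<open>auto simp: B_Suc\<close>)
    show "u (y N) = 0" by (rule yN)
  qed
qed

text \<open>The chain from \<open>x\<close> to \<open>z\<close> has a step of size at least \<open>(1 - q) \<bar>u x\<bar> q\<^sup>k\<close>. The first alternative
  is the case \<open>k = 0\<close>. In the second one \<open>t = \<delta>(x) / 2\<^sup>k\<close>, and the density is integrated with the extra
  weight \<open>\<delta>\<close> to the power \<open>\<eta>\<close>, which is comparable to \<open>t\<close> to the power \<open>\<eta>\<close> on the ball; the exponent
  \<open>2 \<eta>\<close> of \<open>t\<close> is spent once on this weight and once on \<open>q\<^sup>k\<close>.\<close>

lemma chain_dichotomy:
  fixes D :: "'a::euclidean_space set"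
  assumes p: "0 < p" and dsp: "0 \<le> real DIM('a) + s * p" and \<kappa>: "0 < \<kappa>" "\<kappa> < 1" and \<eta>: "0 < \<eta>"
    and D: "open D" "D \<noteq> UNIV" "plump \<kappa> D"
  obtains C where "0 < C"
    and "\<And>u x z. continuous_on UNIV u \<Longrightarrow> x \<in> D \<Longrightarrow> z \<in> frontier D \<Longrightarrow> dist x z \<le> 2 * bdist D x \<Longrightarrow>
      z \<notin> closure {x. u x \<noteq> 0} \<Longrightarrow>
      ennreal (\<bar>u x\<bar> powr p * bdist D x powr (\<beta> - s * p)) \<le> ennreal C * energy_density s p \<beta> D u x \<or>
      (\<exists>t w. 0 < t \<and> t \<le> bdist D x / 2 \<and> ball w (\<kappa> * t / 2) \<subseteq> cball z (2 * t) \<inter> D \<and>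
        ennreal (\<bar>u x\<bar> powr p * t powr (real DIM('a) + \<beta> - s * p + 2 * \<eta>)) \<le>
          ennreal (C * bdist D x powr \<eta>) *
          (\<integral>\<^sup>+y\<in>ball w (\<kappa> * t / 2). ennreal (bdist D y powr \<eta>) * energy_density s p \<beta> D u y \<partial>lborel))"
proof -
  define n where "n = DIM('a)"
  \<comment> \<open>With this ratio, the \<open>p\<close>-th power of \<open>q\<^sup>k\<close> equals \<open>t / \<delta>(x)\<close> to the power \<open>\<eta>\<close>.\<close>
  define q where "q = 2 powr (- \<eta> / p)"
  have q: "0 < q" "q < 1"
    unfolding q_def using p \<eta> powr_less_mono[of "- \<eta> / p" 0 2] by (auto simp: divide_less_0_iff)
  define S where "S = step_const \<kappa> s p \<beta> TYPE('a)"
  have S: "0 < S" unfolding S_def using \<kappa>(1) by (rule step_const_pos)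
  define a where "a = 1 / (1 - q) powr p"
  have a: "0 < a" using q by (simp add: a_def)
  define b where "b = 3 / (unit_ball_vol n * (\<kappa> / 2) ^ n) * (2 / \<kappa>) powr \<eta>"
  have b: "0 < b" using \<kappa> by (simp add: b_def)
  define C where "C = max (a * S) (a * S * b)"
  have C: "0 < C" "a * S \<le> C" "a * S * b \<le> C"
    using a b S by (auto simp: C_def less_max_iff_disj)
  show thesis
  proof (rule that[OF C(1)])
    fix u :: "'a \<Rightarrow> real" and x z
    assume u: "continuous_on UNIV u" and x: "x \<in> D" and z: "z \<in> frontier D"
      "dist x z \<le> 2 * bdist D x" "z \<notin> closure {x. u x \<noteq> 0}"
    let ?G = "energy_density s p \<beta> D u"
    have [measurable]: "?G \<in> borel_measurable borel"
      by (rule energy_density_measurable[OF u D(1)])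
    define d where "d = bdist D x"
    have d: "0 < d" unfolding d_def using D x by (intro bdist_pos)
    define r where "r k = d / 2 ^ k" for k
    obtain y w N where y0: "y 0 = x" and yN: "u (y N) = 0"
      and wD: "\<And>k. ball (w k) (\<kappa> * r k) \<subseteq> D" and wz: "\<And>k. w k \<in> cball z (r k)"
      and step: "\<And>k. ennreal (\<bar>u (y k) - u (y (Suc k))\<bar> powr p) \<le> ennreal (S * r k powr (s * p - \<beta>)) * ?G (y k)"
      and avg: "\<And>k. 0 < k \<Longrightarrow> ?G (y k) * emeasure lborel (ball (w k) (\<kappa> * r k / 2)) \<le>
        3 * (\<integral>\<^sup>+v\<in>ball (w k) (\<kappa> * r k / 2). ?G v \<partial>lborel)"
      unfolding S_def r_def d_def by (rule plump_chain[OF dsp \<kappa> D u x z]) blast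
    obtain k where k: "\<bar>u x\<bar> * (1 - q) * q ^ k \<le> \<bar>u (y k) - u (y (Suc k))\<bar>"
      using telescoping_geometric_step[of "\<lambda>k. u (y k)", OF yN q] y0 by auto
    define t where "t = r k"
    have t: "0 < t" "t \<le> d" using d by (auto simp: t_def r_def divide_le_eq mult_le_cancel_left1)
    have "(\<bar>u x\<bar> * (1 - q) * q ^ k) powr p \<le> \<bar>u (y k) - u (y (Suc k))\<bar> powr p"
      using k q p by (intro powr_mono2) auto
    also have "(\<bar>u x\<bar> * (1 - q) * q ^ k) powr p = \<bar>u x\<bar> powr p / a * (t / d) powr \<eta>"
    proof -
      have "(q ^ k) powr p = (t / d) powr \<eta>"
      proof -
        have "t / d = 2 powr - real k"
          using d by (simp add: t_def r_def powr_minus powr_realpow field_simps)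
        then show ?thesis
          using q p by (simp add: powr_powr q_def mult.commute flip: powr_realpow)
      qed
      then show ?thesis
        using q by (simp add: powr_mult a_def)
    qed
    finally have "ennreal (\<bar>u x\<bar> powr p / a * (t / d) powr \<eta>) \<le> ennreal (\<bar>u (y k) - u (y (Suc k))\<bar> powr p)"
      by (rule ennreal_leI)
    also have "\<dots> \<le> ennreal (S * t powr (s * p - \<beta>)) * ?G (y k)"
      unfolding t_def by (rule step)
    finally have main: "ennreal (\<bar>u x\<bar> powr p / a * (t / d) powr \<eta>) \<le> ennreal (S * t powr (s * p - \<beta>)) * ?G (y k)" .
    show "ennreal (\<bar>u x\<bar> powr p * bdist D x powr (\<beta> - s * p)) \<le> ennreal C * ?G x \<or>
      (\<exists>t w. 0 < t \<and> t \<le> bdist D x / 2 \<and> ball w (\<kappa> * t / 2) \<subseteq> cball z (2 * t) \<inter> D \<and>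
        ennreal (\<bar>u x\<bar> powr p * t powr (real DIM('a) + \<beta> - s * p + 2 * \<eta>)) \<le>
          ennreal (C * bdist D x powr \<eta>) *
          (\<integral>\<^sup>+y\<in>ball w (\<kappa> * t / 2). ennreal (bdist D y powr \<eta>) * ?G y \<partial>lborel))"
    proof (cases "k = 0")
      case True
      then have "t = d" by (simp add: t_def r_def)
      have "ennreal (a * d powr (\<beta> - s * p) * (\<bar>u x\<bar> powr p / a * (t / d) powr \<eta>))
          \<le> ennreal (a * d powr (\<beta> - s * p) * (S * t powr (s * p - \<beta>))) * ?G (y k)"
        using a by (intro ennreal_scale_le[OF main]) auto
      also have "a * d powr (\<beta> - s * p) * (\<bar>u x\<bar> powr p / a * (t / d) powr \<eta>) = \<bar>u x\<bar> powr p * d powr (\<beta> - s * p)"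
        using a d by (simp add: \<open>t = d\<close>)
      also have "a * d powr (\<beta> - s * p) * (S * t powr (s * p - \<beta>)) = a * S"
        using d by (simp add: \<open>t = d\<close> powr_diff)
      finally have "ennreal (\<bar>u x\<bar> powr p * d powr (\<beta> - s * p)) \<le> ennreal (a * S) * ?G x"
        using True y0 by simp
      also have "\<dots> \<le> ennreal C * ?G x"
        using C by (intro mult_right_mono ennreal_leI) auto
      finally show ?thesis by (simp add: d_def)
    next
      case False
      define B where "B = ball (w k) (\<kappa> * t / 2)"
      have [measurable]: "B \<in> sets borel" by (simp add: B_def)
      define J where "J = (\<integral>\<^sup>+y\<in>B. ennreal (bdist D y powr \<eta>) * ?G y \<partial>lborel)"
      have "\<kappa> * t / 2 \<le> \<kappa> * t" using \<kappa> t by simp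
      then have BD: "B \<subseteq> D"
        using wD[of k] unfolding B_def t_def by (meson order_trans subset_ball)
      have Bz: "B \<subseteq> cball z (2 * t)"
      proof
        fix v assume "v \<in> B"
        have "dist z v \<le> dist z (w k) + dist (w k) v" by (rule dist_triangle)
        also have "\<dots> \<le> t + \<kappa> * t / 2"
          using \<open>v \<in> B\<close> wz[of k] by (intro add_mono) (auto simp: B_def t_def)
        also have "\<kappa> * t \<le> 1 * t" using \<kappa> t by (intro mult_right_mono) auto
        finally show "v \<in> cball z (2 * t)" using t by simp
      qed
      have B_far: "\<kappa> * t / 2 \<le> bdist D v" if "v \<in> B" for v
        using bdist_ge_half_radius[OF wD[of k] D(2), of v] that by (simp add: B_def t_def)
      have em: "emeasure lborel B = ennreal (unit_ball_vol n * (\<kappa> * t / 2) ^ n)"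
        unfolding B_def n_def using \<kappa> t by (intro emeasure_ball) auto
      have "?G (y k) * ennreal (unit_ball_vol n * (\<kappa> * t / 2) ^ n) \<le> ennreal 3 * (\<integral>\<^sup>+v\<in>B. ?G v \<partial>lborel)"
        using avg[of k] False by (simp add: t_def[symmetric] B_def[symmetric] em)
      then have G1: "?G (y k) \<le> ennreal (3 / (unit_ball_vol n * (\<kappa> * t / 2) ^ n)) * (\<integral>\<^sup>+v\<in>B. ?G v \<partial>lborel)"
        using \<kappa> t by (intro le_ennreal_divideI) auto
      have G2: "(\<integral>\<^sup>+v\<in>B. ?G v \<partial>lborel) \<le> ennreal ((2 / \<kappa>) powr \<eta> * t powr - \<eta>) * J"
      proof -
        have "(\<integral>\<^sup>+v\<in>B. ?G v \<partial>lborel) \<le>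
          (\<integral>\<^sup>+v. ennreal ((2 / \<kappa>) powr \<eta> * t powr - \<eta>) * (ennreal (bdist D v powr \<eta>) * ?G v * indicator B v) \<partial>lborel)"
        proof (rule nn_integral_mono)
          fix v
          show "?G v * indicator B v \<le>
            ennreal ((2 / \<kappa>) powr \<eta> * t powr - \<eta>) * (ennreal (bdist D v powr \<eta>) * ?G v * indicator B v)"
          proof (cases "v \<in> B")
            case True
            have "1 = (2 / \<kappa>) powr \<eta> * t powr - \<eta> * (\<kappa> * t / 2) powr \<eta>"
              using \<kappa> t by (simp add: powr_mult powr_divide powr_minus)
            also have "\<dots> \<le> (2 / \<kappa>) powr \<eta> * t powr - \<eta> * bdist D v powr \<eta>"
              using \<kappa> t \<eta> B_far[OF True] by (intro mult_left_mono powr_mono2) auto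
            finally have "1 \<le> ennreal ((2 / \<kappa>) powr \<eta> * t powr - \<eta>) * ennreal (bdist D v powr \<eta>)"
              by (simp flip: ennreal_mult')
            then have "1 * ?G v \<le> ennreal ((2 / \<kappa>) powr \<eta> * t powr - \<eta>) * ennreal (bdist D v powr \<eta>) * ?G v"
              by (rule mult_right_mono) simp
            then show ?thesis using True by (simp add: mult.assoc)
          qed simp
        qed
        also have "\<dots> = ennreal ((2 / \<kappa>) powr \<eta> * t powr - \<eta>) * J"
          unfolding J_def by (rule nn_integral_cmult) measurable
        finally show ?thesis .
      qed
      have "?G (y k) \<le> ennreal (3 / (unit_ball_vol n * (\<kappa> * t / 2) ^ n) * ((2 / \<kappa>) powr \<eta> * t powr - \<eta>)) * J"
        using \<kappa> t by (intro ennreal_scale_trans[OF G1 G2]) auto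
      also have "3 / (unit_ball_vol n * (\<kappa> * t / 2) ^ n) * ((2 / \<kappa>) powr \<eta> * t powr - \<eta>) = b * t powr (- real n - \<eta>)"
      proof -
        have "t powr (- real n - \<eta>) = t powr - \<eta> / t ^ n"
          using t by (subst minus_diff_commute) (simp only: powr_diff powr_realpow)
        moreover have "(\<kappa> * t / 2) ^ n = (\<kappa> / 2) ^ n * t ^ n"
          by (simp add: power_mult_distrib[symmetric])
        ultimately show ?thesis by (simp add: b_def)
      qed
      finally have G3: "?G (y k) \<le> ennreal (b * t powr (- real n - \<eta>)) * J" .
      have "ennreal (\<bar>u x\<bar> powr p / a * (t / d) powr \<eta>)
          \<le> ennreal (S * t powr (s * p - \<beta>) * (b * t powr (- real n - \<eta>))) * J"
        using S by (intro ennreal_scale_trans[OF main G3]) simp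
      note main' = this
      have exponent: "real n + \<beta> - s * p + \<eta> + \<eta> = real n + \<beta> - s * p + 2 * \<eta>"
        by simp
      \<comment> \<open>Normalise so that on the right only the weighted integral, the constant and one power of
        the distance remain.\<close>
      from ennreal_scale_le[OF main', of "a * d powr \<eta> * t powr (real n + \<beta> - s * p + \<eta>)"]
      have "ennreal (a * d powr \<eta> * t powr (real n + \<beta> - s * p + \<eta>) * (\<bar>u x\<bar> powr p / a * (t / d) powr \<eta>))
        \<le> ennreal (a * d powr \<eta> * t powr (real n + \<beta> - s * p + \<eta>) *
            (S * t powr (s * p - \<beta>) * (b * t powr (- real n - \<eta>)))) * J"
        using a by simp
      also have "a * d powr \<eta> * t powr (real n + \<beta> - s * p + \<eta>) * (\<bar>u x\<bar> powr p / a * (t / d) powr \<eta>)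
          = \<bar>u x\<bar> powr p * (t powr (real n + \<beta> - s * p + \<eta>) * t powr \<eta>)"
        using a d t by (simp add: powr_divide)
      also have "t powr (real n + \<beta> - s * p + \<eta>) * t powr \<eta> = t powr (real n + \<beta> - s * p + 2 * \<eta>)"
        by (simp only: powr_add[symmetric] exponent)
      also have "a * d powr \<eta> * t powr (real n + \<beta> - s * p + \<eta>) * (S * t powr (s * p - \<beta>) * (b * t powr (- real n - \<eta>)))
          = a * S * b * d powr \<eta> * (t powr (real n + \<beta> - s * p + \<eta>) * t powr (s * p - \<beta>) * t powr (- real n - \<eta>))"
        by (simp add: mult_ac)
      also have "t powr (real n + \<beta> - s * p + \<eta>) * t powr (s * p - \<beta>) * t powr (- real n - \<eta>) = 1"
        using t by (simp flip: powr_add)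
      finally have "ennreal (\<bar>u x\<bar> powr p * t powr (real n + \<beta> - s * p + 2 * \<eta>)) \<le> ennreal (a * S * b * d powr \<eta>) * J"
        by simp
      also have "\<dots> \<le> ennreal (C * d powr \<eta>) * J"
        using C by (intro mult_right_mono ennreal_leI) auto
      finally have fin: "ennreal (\<bar>u x\<bar> powr p * t powr (real n + \<beta> - s * p + 2 * \<eta>)) \<le> ennreal (C * d powr \<eta>) * J" .
      have "(2::real) ^ 1 \<le> 2 ^ k" using False by (intro power_increasing) auto
      then have "t \<le> d / 2"
        using d unfolding t_def r_def by (intro divide_left_mono) auto
      then show ?thesis
        using fin t BD Bz unfolding d_def n_def J_def B_def by blast
    qed
  qed
qed

section \<open>The pointwise inequality and its integral\<close>

text \<open>If the energy density at \<open>x\<close> does not control \<open>\<bar>u x\<bar>\<close>, the second alternative of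
  \<open>chain_dichotomy\<close> holds at every boundary point within \<open>\<delta>(x)\<close> of a nearest one. Vitali's lemma
  selects disjoint balls whose fivefold enlargements cover this piece of the boundary. The energies of the
  selected balls add up to at most the energy near \<open>x\<close>, and the \<open>lam\<close>-th powers of the enlarged radii add up to
  at least the content of the piece.\<close>

lemma pointwise_hardy:
  fixes D :: "'a::euclidean_space set"
  assumes p: "0 < p" and dsp: "0 \<le> real DIM('a) + s * p" and \<kappa>: "0 < \<kappa>" "\<kappa> < 1" and \<eta>: "0 < \<eta>"
    and D: "open D" "D \<noteq> UNIV" "plump \<kappa> D"
    and lam: "lam = real DIM('a) + \<beta> - s * p + 2 * \<eta>" and c: "0 < c"
    and fat: "\<And>x z. x \<in> D \<Longrightarrow> z \<in> frontier D \<Longrightarrow>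
      ennreal (c * bdist D x powr lam) \<le> hausdorff_content lam (ball z (bdist D x) \<inter> frontier D)"
  obtains C where "0 < C"
    and "\<And>u x. u \<in> test_functions D \<Longrightarrow> x \<in> D \<Longrightarrow>
      ennreal (\<bar>u x\<bar> powr p * bdist D x powr (\<beta> - s * p)) \<le>
        ennreal C * (energy_density s p \<beta> D u x + ennreal (bdist D x powr (- real DIM('a) - \<eta>)) *
          (\<integral>\<^sup>+y\<in>{y\<in>D. dist x y \<le> 4 * bdist D x}.
            ennreal (bdist D y powr \<eta>) * energy_density s p \<beta> D u y \<partial>lborel))"
proof -
  obtain C where C: "0 < C"
    and dichotomy: "\<And>u x z. continuous_on UNIV u \<Longrightarrow> x \<in> D \<Longrightarrow> z \<in> frontier D \<Longrightarrow> dist x z \<le> 2 * bdist D x \<Longrightarrow>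
      z \<notin> closure {x. u x \<noteq> 0} \<Longrightarrow>
      ennreal (\<bar>u x\<bar> powr p * bdist D x powr (\<beta> - s * p)) \<le> ennreal C * energy_density s p \<beta> D u x \<or>
      (\<exists>t w. 0 < t \<and> t \<le> bdist D x / 2 \<and> ball w (\<kappa> * t / 2) \<subseteq> cball z (2 * t) \<inter> D \<and>
        ennreal (\<bar>u x\<bar> powr p * t powr lam) \<le>
          ennreal (C * bdist D x powr \<eta>) *
          (\<integral>\<^sup>+y\<in>ball w (\<kappa> * t / 2). ennreal (bdist D y powr \<eta>) * energy_density s p \<beta> D u y \<partial>lborel))"
    unfolding lam by (rule chain_dichotomy[OF p dsp \<kappa> \<eta> D, of \<beta>]) blast
  define C' where "C' = max C (10 powr lam * C / c)"
  have C': "0 < C'" "C \<le> C'" "10 powr lam * C / c \<le> C'"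
    using C c by (auto simp: C'_def less_max_iff_disj)
  show thesis
  proof (rule that[OF C'(1)])
    fix u x
    assume test: "u \<in> test_functions D" and x: "x \<in> D"
    have "C_k 0 u" using test by (simp add: test_functions_def smooth_def del: C_k.simps)
    then have u: "continuous_on UNIV u" by simp
    let ?G = "energy_density s p \<beta> D u"
    have [measurable]: "?G \<in> borel_measurable borel"
      by (rule energy_density_measurable[OF u D(1)])
    define d where "d = bdist D x"
    have d: "0 < d" unfolding d_def using D x by (intro bdist_pos)
    define A where "A = {y\<in>D. dist x y \<le> 4 * d}"
    define f where "f y = ennreal (bdist D y powr \<eta>) * ?G y" for y
    have f[measurable]: "f \<in> borel_measurable borel"
      unfolding f_def[abs_def] by measurable
    define J where "J = (\<integral>\<^sup>+y\<in>A. f y \<partial>lborel)"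
    define X where "X = \<bar>u x\<bar> powr p"
    have "ennreal (X * d powr (\<beta> - s * p)) \<le> ennreal C' * (?G x + ennreal (d powr (- real DIM('a) - \<eta>)) * J)"
    proof (cases "ennreal (X * d powr (\<beta> - s * p)) \<le> ennreal C * ?G x")
      case True
      note this
      also have "ennreal C * ?G x \<le> ennreal C' * (?G x + ennreal (d powr (- real DIM('a) - \<eta>)) * J)"
        using C' by (intro mult_mono ennreal_leI) auto
      finally show ?thesis .
    next
      case False
      then have X: "0 < X" by (cases "X = 0") (auto simp: X_def)
      have "closed (- D)" "- D \<noteq> {}" using D by auto
      then obtain z0 where z0: "z0 \<in> - D" "d = dist x z0"
        unfolding d_def by (rule infdist_attains_inf)
      \<comment> \<open>A boundary point of \<open>D\<close> whose distance to \<open>x\<close> is at most \<open>\<delta>(x)\<close>.\<close>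
      obtain z1 where z1: "z1 \<in> closed_segment x z0" "z1 \<in> frontier D"
        using connected_Int_frontier[of "closed_segment x z0" D] x z0(1) by auto
      have "dist x z1 \<le> d"
        using z1(1) z0(2) by (metis dist_in_closed_segment dist_commute)
      define E where "E = ball z1 d \<inter> frontier D"
      have E: "z \<in> frontier D" "dist x z \<le> 2 * d" if "z \<in> E" for z
        using that \<open>dist x z1 \<le> d\<close> dist_triangle[of x z z1] by (auto simp: E_def)
      have supp: "z \<notin> closure {x. u x \<noteq> 0}" if "z \<in> frontier D" for z
        using test frontier_imp_not_mem[OF D(1) that] by (auto simp: test_functions_def)
      define sel where "sel z t w \<longleftrightarrow> 0 < t \<and> t \<le> d / 2 \<and> ball w (\<kappa> * t / 2) \<subseteq> cball z (2 * t) \<inter> D \<and>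
        ennreal (X * t powr lam) \<le> ennreal (C * d powr \<eta>) * (\<integral>\<^sup>+y\<in>ball w (\<kappa> * t / 2). f y \<partial>lborel)"
        for z t w
      have "\<forall>z\<in>E. \<exists>t w. sel z t w"
        using dichotomy[OF u x E(1) _ supp[OF E(1)]] E(2) False
        unfolding sel_def X_def d_def f_def by blast
      then obtain t w where sel: "\<And>z. z \<in> E \<Longrightarrow> sel z (t z) (w z)"
        by metis
      note tw = sel[unfolded sel_def]
      define B where "B z = ball (w z) (\<kappa> * t z / 2)" for z
      obtain K where K: "countable K" "K \<subseteq> E"
        and disj: "pairwise (\<lambda>i j. disjnt (cball i (2 * t i)) (cball j (2 * t j))) K"
        and cov: "\<And>i. i \<in> E \<Longrightarrow> \<exists>j. j \<in> K \<and> \<not> disjnt (cball i (2 * t i)) (cball j (2 * t j)) \<and>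
          cball i (2 * t i) \<subseteq> ball j (5 * (2 * t j))"
        by (rule Vitali_covering_lemma_cballs_balls[of E "\<lambda>z. 2 * t z" d "\<lambda>z. z"]) (use tw in fastforce)+
      \<comment> \<open>The enlarged balls have radius \<open>10 t\<close>, whence the power of \<open>10\<close>.\<close>
      define M where "M = ennreal (10 powr lam * C * d powr \<eta> / X) * J"
      have "hausdorff_content lam E \<le> M"
      proof (rule hausdorff_content_le_countable_cover)
        show "countable K" by fact
        show "0 < 10 * t z" if "z \<in> K" for z using tw K that by auto
        show "E \<subseteq> (\<Union>z\<in>K. ball z (10 * t z))"
        proof
          fix z assume "z \<in> E"
          then obtain j where "j \<in> K" "cball z (2 * t z) \<subseteq> ball j (10 * t j)"
            using cov by fastforce
          moreover have "z \<in> cball z (2 * t z)" using tw[OF \<open>z \<in> E\<close>] by simp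
          ultimately show "z \<in> (\<Union>z\<in>K. ball z (10 * t z))" by blast
        qed
      next
        fix F assume F: "finite F" "F \<subseteq> K"
        have FE: "z \<in> E" if "z \<in> F" for z using F K that by auto
        have "(\<Sum>z\<in>F. ennreal ((10 * t z) powr lam)) \<le>
            (\<Sum>z\<in>F. ennreal (10 powr lam * C * d powr \<eta> / X) * (\<integral>\<^sup>+y\<in>B z. f y \<partial>lborel))"
        proof (rule sum_mono)
          fix z assume "z \<in> F"
          note z = tw[OF FE[OF this]]
          have "ennreal (10 powr lam / X * (X * t z powr lam)) \<le>
              ennreal (10 powr lam / X * (C * d powr \<eta>)) * (\<integral>\<^sup>+y\<in>B z. f y \<partial>lborel)"
            using z X unfolding B_def by (intro ennreal_scale_le) auto
          moreover have "(10 * t z) powr lam = 10 powr lam / X * (X * t z powr lam)"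
            using X z by (simp add: powr_mult)
          ultimately show "ennreal ((10 * t z) powr lam) \<le>
              ennreal (10 powr lam * C * d powr \<eta> / X) * (\<integral>\<^sup>+y\<in>B z. f y \<partial>lborel)"
            by (simp add: mult.assoc)
        qed
        also have "\<dots> = ennreal (10 powr lam * C * d powr \<eta> / X) * (\<Sum>z\<in>F. \<integral>\<^sup>+y\<in>B z. f y \<partial>lborel)"
          by (simp add: sum_distrib_left)
        also have "\<dots> \<le> M"
          unfolding M_def J_def
        proof (intro mult_left_mono sum_nn_integral_disjoint_le)
          show "disjoint_family_on B F"
            unfolding disjoint_family_on_def
          proof (intro ballI impI)
            fix i j assume ij: "i \<in> F" "j \<in> F" "i \<noteq> j"
            then have "cball i (2 * t i) \<inter> cball j (2 * t j) = {}"
              using disj F by (auto simp: pairwise_def disjnt_def)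
            moreover have "B i \<subseteq> cball i (2 * t i)" "B j \<subseteq> cball j (2 * t j)"
              using tw[OF FE[OF ij(1)]] tw[OF FE[OF ij(2)]] by (auto simp: B_def)
            ultimately show "B i \<inter> B j = {}" by blast
          qed
          show "B z \<subseteq> A" if "z \<in> F" for z
          proof
            fix y assume "y \<in> B z"
            note z = tw[OF FE[OF that]] and zE = E[OF FE[OF that]]
            have y: "dist z y \<le> 2 * t z" "y \<in> D" using z \<open>y \<in> B z\<close> by (auto simp: B_def)
            have "dist x y \<le> dist x z + dist z y" by (rule dist_triangle)
            then show "y \<in> A" using y z zE(2) d by (auto simp: A_def)
          qed
        qed (use F in \<open>auto simp: B_def\<close>)
        finally show "(\<Sum>z\<in>F. ennreal ((10 * t z) powr lam)) \<le> M" .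
      qed
      have exponent: "\<beta> - s * p - lam + \<eta> = - real DIM('a) - \<eta>"
        by (simp add: lam)
      from \<open>hausdorff_content lam E \<le> M\<close> fat[OF x z1(2)] have "ennreal (c * d powr lam) \<le> ennreal (10 powr lam * C * d powr \<eta> / X) * J"
        by (simp add: d_def E_def M_def)
      \<comment> \<open>Solve for the left-hand side of the claim.\<close>
      from ennreal_scale_le[OF this, of "X / c * d powr (\<beta> - s * p - lam)"]
      have "ennreal (X / c * d powr (\<beta> - s * p - lam) * (c * d powr lam)) \<le>
          ennreal (X / c * d powr (\<beta> - s * p - lam) * (10 powr lam * C * d powr \<eta> / X)) * J"
        using X c by simp
      also have "X / c * d powr (\<beta> - s * p - lam) * (c * d powr lam) = X * (d powr (\<beta> - s * p - lam) * d powr lam)"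
        using c by simp
      also have "d powr (\<beta> - s * p - lam) * d powr lam = d powr (\<beta> - s * p)"
        by (simp flip: powr_add)
      also have "X / c * d powr (\<beta> - s * p - lam) * (10 powr lam * C * d powr \<eta> / X)
          = 10 powr lam * C / c * (d powr (\<beta> - s * p - lam) * d powr \<eta>)"
        using X by simp
      also have "d powr (\<beta> - s * p - lam) * d powr \<eta> = d powr (- real DIM('a) - \<eta>)"
        by (simp only: powr_add[symmetric] exponent)
      also have "ennreal (10 powr lam * C / c * d powr (- real DIM('a) - \<eta>)) * J
          \<le> ennreal (C' * d powr (- real DIM('a) - \<eta>)) * J"
        using C'(3) by (intro mult_right_mono ennreal_leI) auto
      also have "\<dots> = ennreal C' * (ennreal (d powr (- real DIM('a) - \<eta>)) * J)"
        using C' by (simp add: ennreal_mult mult.assoc)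
      also have "\<dots> \<le> ennreal C' * (?G x + ennreal (d powr (- real DIM('a) - \<eta>)) * J)"
        by (intro mult_left_mono) auto
      finally show ?thesis .
    qed
    then show "ennreal (\<bar>u x\<bar> powr p * bdist D x powr (\<beta> - s * p)) \<le>
        ennreal C' * (?G x + ennreal (bdist D x powr (- real DIM('a) - \<eta>)) *
          (\<integral>\<^sup>+y\<in>{y\<in>D. dist x y \<le> 4 * bdist D x}. ennreal (bdist D y powr \<eta>) * ?G y \<partial>lborel))"
      by (simp add: X_def d_def J_def A_def f_def)
  qed
qed

text \<open>After exchanging the integrals, \<open>y\<close> is fixed and \<open>x\<close> ranges over a cone over \<open>y\<close>. There
  \<open>\<delta>(y) \<le> \<delta>(x) + \<bar>x - y\<bar> \<le> 5 \<delta>(x)\<close>, so the integral over \<open>x\<close> is at most a constant times \<open>\<delta>(y)\<close> to the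
  power \<open>- \<eta>\<close>, and this cancels the weight.\<close>

lemma cone_average_integral_le:
  fixes D :: "'a::euclidean_space set"
  assumes [measurable]: "G \<in> borel_measurable borel" and D: "open D" "D \<noteq> UNIV" and \<eta>: "0 < \<eta>"
  shows "(\<integral>\<^sup>+x\<in>D. ennreal (bdist D x powr (- real DIM('a) - \<eta>)) *
      (\<integral>\<^sup>+y\<in>{y\<in>D. dist x y \<le> 4 * bdist D x}. ennreal (bdist D y powr \<eta>) * G y \<partial>lborel) \<partial>lborel)
    \<le> ennreal (unit_ball_vol DIM('a) * 8 ^ DIM('a) / (1 - 2 powr - \<eta>) * 5 powr \<eta>) *
      (\<integral>\<^sup>+y\<in>D. G y \<partial>lborel)"
proof -
  define K where "K = unit_ball_vol DIM('a) * 8 ^ DIM('a) / (1 - 2 powr - \<eta>)"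
  define A where "A y = {x\<in>D. dist x y \<le> 4 * bdist D x}" for y
  have [measurable]: "D \<in> sets borel" using D by auto
  define h where "h x y = (if x \<in> D \<and> y \<in> D \<and> dist x y \<le> 4 * bdist D x
    then ennreal (bdist D x powr (- real DIM('a) - \<eta>)) * (ennreal (bdist D y powr \<eta>) * G y) else 0)" for x y
  have h_meas: "case_prod h \<in> borel_measurable (lborel \<Otimes>\<^sub>M lborel)"
    unfolding h_def by measurable
  have A_meas[measurable]: "A y \<in> sets borel" for y
    unfolding A_def by measurable
  have "ennreal (bdist D x powr (- real DIM('a) - \<eta>)) *
      (\<integral>\<^sup>+y\<in>{y\<in>D. dist x y \<le> 4 * bdist D x}. ennreal (bdist D y powr \<eta>) * G y \<partial>lborel) * indicator D x
    = (\<integral>\<^sup>+y. h x y \<partial>lborel)" for x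
  proof (cases "x \<in> D")
    case True
    have "(\<integral>\<^sup>+y. h x y \<partial>lborel) = (\<integral>\<^sup>+y. ennreal (bdist D x powr (- real DIM('a) - \<eta>)) *
        (ennreal (bdist D y powr \<eta>) * G y * indicator {y\<in>D. dist x y \<le> 4 * bdist D x} y) \<partial>lborel)"
      using True by (intro nn_integral_cong) (auto simp: h_def indicator_def)
    also have "\<dots> = ennreal (bdist D x powr (- real DIM('a) - \<eta>)) *
      (\<integral>\<^sup>+y\<in>{y\<in>D. dist x y \<le> 4 * bdist D x}. ennreal (bdist D y powr \<eta>) * G y \<partial>lborel)"
      by (rule nn_integral_cmult) measurable
    finally show ?thesis using True by simp
  qed (simp add: h_def)
  then have "(\<integral>\<^sup>+x\<in>D. ennreal (bdist D x powr (- real DIM('a) - \<eta>)) *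
      (\<integral>\<^sup>+y\<in>{y\<in>D. dist x y \<le> 4 * bdist D x}. ennreal (bdist D y powr \<eta>) * G y \<partial>lborel) \<partial>lborel)
    = (\<integral>\<^sup>+x. \<integral>\<^sup>+y. h x y \<partial>lborel \<partial>lborel)"
    by simp
  also have "\<dots> = (\<integral>\<^sup>+y. \<integral>\<^sup>+x. h x y \<partial>lborel \<partial>lborel)"
    by (rule lborel_pair.Fubini'[symmetric]) (rule h_meas)
  also have "\<dots> \<le> (\<integral>\<^sup>+y. ennreal (K * 5 powr \<eta>) * (G y * indicator D y) \<partial>lborel)"
  proof (rule nn_integral_mono)
    fix y
    show "(\<integral>\<^sup>+x. h x y \<partial>lborel) \<le> ennreal (K * 5 powr \<eta>) * (G y * indicator D y)"
    proof (cases "y \<in> D")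
      case True
      have dy: "0 < bdist D y" using D True by (intro bdist_pos)
      have K0: "0 \<le> K"
        using powr_less_mono[of "- \<eta>" 0 2] \<eta> by (simp add: K_def)
      have "(\<integral>\<^sup>+x. h x y \<partial>lborel) = (\<integral>\<^sup>+x. (ennreal (bdist D y powr \<eta>) * G y) *
          (ennreal (bdist D x powr (- real DIM('a) - \<eta>)) * indicator (A y) x) \<partial>lborel)"
        using True by (intro nn_integral_cong) (auto simp: h_def A_def indicator_def mult_ac)
      also have "\<dots> = (ennreal (bdist D y powr \<eta>) * G y) *
          (\<integral>\<^sup>+x\<in>A y. ennreal (bdist D x powr (- real DIM('a) - \<eta>)) \<partial>lborel)"
        by (intro nn_integral_cmult) measurable
      also have "\<dots> \<le> (ennreal (bdist D y powr \<eta>) * G y) * ennreal (K * (bdist D y / 5) powr - \<eta>)"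
        unfolding K_def
      proof (intro mult_left_mono nn_integral_cone_le[where y = y])
        show "bdist D y / 5 \<le> bdist D x" if "x \<in> A y" for x
          using infdist_triangle[of y "- D" x] that by (auto simp: A_def dist_commute)
      qed (use A_meas \<eta> dy in \<open>auto simp: A_def\<close>)
      also have "\<dots> = ennreal (bdist D y powr \<eta> * (K * (bdist D y / 5) powr - \<eta>)) * G y"
        using K0 by (simp add: ennreal_mult mult_ac)
      also have "bdist D y powr \<eta> * (K * (bdist D y / 5) powr - \<eta>) = K * 5 powr \<eta>"
        using dy by (simp add: powr_divide powr_minus)
      finally show ?thesis using True by simp
    qed (simp add: h_def)
  qed
  also have "\<dots> = ennreal (K * 5 powr \<eta>) * (\<integral>\<^sup>+y\<in>D. G y \<partial>lborel)"
    by (rule nn_integral_cmult) measurable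
  finally show ?thesis by (simp add: K_def)
qed

text \<open>Both fatness conditions enter only through a content bound at the radius \<open>\<delta>(x)\<close>; half of the
  gap between \<open>lam\<close> and the critical exponent \<open>d + \<beta> - s p\<close> serves as \<open>\<eta>\<close>.\<close>

theorem hardy_inequality_of_fatness:
  fixes D :: "'a::euclidean_space set"
  assumes p: "0 < p" and dsp: "0 \<le> real DIM('a) + s * p" and \<kappa>: "0 < \<kappa>" "\<kappa> < 1"
    and D: "open D" "D \<noteq> UNIV" "plump \<kappa> D"
    and lam: "real DIM('a) + \<beta> - s * p < lam" and c: "0 < c"
    and fat: "\<And>x z. x \<in> D \<Longrightarrow> z \<in> frontier D \<Longrightarrow>
      ennreal (c * bdist D x powr lam) \<le> hausdorff_content lam (ball z (bdist D x) \<inter> frontier D)"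
  shows "hardy_inequality s p \<beta> D"
proof -
  define \<eta> where "\<eta> = (lam - (real DIM('a) + \<beta> - s * p)) / 2"
  have \<eta>: "0 < \<eta>" "lam = real DIM('a) + \<beta> - s * p + 2 * \<eta>"
    using lam by (simp_all add: \<eta>_def field_simps)
  define K where "K = unit_ball_vol DIM('a) * 8 ^ DIM('a) / (1 - 2 powr - \<eta>) * 5 powr \<eta>"
  have K: "0 \<le> K"
    using powr_less_mono[of "- \<eta>" 0 2] \<eta>(1) by (simp add: K_def)
  obtain C where C: "0 < C"
    and pw: "\<And>u x. u \<in> test_functions D \<Longrightarrow> x \<in> D \<Longrightarrow>
      ennreal (\<bar>u x\<bar> powr p * bdist D x powr (\<beta> - s * p)) \<le>
        ennreal C * (energy_density s p \<beta> D u x + ennreal (bdist D x powr (- real DIM('a) - \<eta>)) *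
          (\<integral>\<^sup>+y\<in>{y\<in>D. dist x y \<le> 4 * bdist D x}.
            ennreal (bdist D y powr \<eta>) * energy_density s p \<beta> D u y \<partial>lborel))"
    by (rule pointwise_hardy[OF p dsp \<kappa> \<eta>(1) D \<eta>(2) c fat]) blast+
  show ?thesis
    unfolding hardy_inequality_def
  proof (intro exI conjI ballI)
    show "0 < C * (1 + K)" using C K by simp
  next
    fix u assume test: "u \<in> test_functions D"
    have "C_k 0 u" using test by (simp add: test_functions_def smooth_def del: C_k.simps)
    then have u: "continuous_on UNIV u" by simp
    let ?G = "energy_density s p \<beta> D u"
    have [measurable]: "?G \<in> borel_measurable borel"
      by (rule energy_density_measurable[OF u D(1)])
    have [measurable]: "D \<in> sets borel" using D by auto
    define Q where "Q x = ennreal (bdist D x powr (- real DIM('a) - \<eta>)) *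
      (\<integral>\<^sup>+y\<in>{y\<in>D. dist x y \<le> 4 * bdist D x}. ennreal (bdist D y powr \<eta>) * ?G y \<partial>lborel)" for x
    have Q[measurable]: "Q \<in> borel_measurable borel"
    proof -
      have "(\<lambda>x. ennreal (bdist D x powr (- real DIM('a) - \<eta>)) *
          (\<integral>\<^sup>+y. (if y \<in> D \<and> dist x y \<le> 4 * bdist D x then ennreal (bdist D y powr \<eta>) * ?G y else 0) \<partial>lborel))
          \<in> borel_measurable borel"
        by measurable
      also have "(\<lambda>x. ennreal (bdist D x powr (- real DIM('a) - \<eta>)) *
          (\<integral>\<^sup>+y. (if y \<in> D \<and> dist x y \<le> 4 * bdist D x then ennreal (bdist D y powr \<eta>) * ?G y else 0) \<partial>lborel)) = Q"
        unfolding Q_def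
        by (intro ext arg_cong2[where f="(*)"] refl nn_integral_cong) (auto simp: indicator_def)
      finally show ?thesis .
    qed
    have "(\<integral>\<^sup>+x\<in>D. ennreal (\<bar>u x\<bar> powr p / bdist D x powr (s * p) * bdist D x powr \<beta>) \<partial>lborel)
        \<le> (\<integral>\<^sup>+x. ennreal C * (?G x * indicator D x + Q x * indicator D x) \<partial>lborel)"
    proof (rule nn_integral_mono)
      fix x
      show "ennreal (\<bar>u x\<bar> powr p / bdist D x powr (s * p) * bdist D x powr \<beta>) * indicator D x
          \<le> ennreal C * (?G x * indicator D x + Q x * indicator D x)"
      proof (cases "x \<in> D")
        case True
        then have "\<bar>u x\<bar> powr p / bdist D x powr (s * p) * bdist D x powr \<beta> = \<bar>u x\<bar> powr p * bdist D x powr (\<beta> - s * p)"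
          by (simp add: powr_diff)
        then show ?thesis using pw[OF test True] True by (simp add: Q_def)
      qed simp
    qed
    also have "\<dots> = ennreal C * ((\<integral>\<^sup>+x\<in>D. ?G x \<partial>lborel) + (\<integral>\<^sup>+x\<in>D. Q x \<partial>lborel))"
      by (simp add: nn_integral_cmult nn_integral_add)
    also have "\<dots> \<le> ennreal C * ((\<integral>\<^sup>+x\<in>D. ?G x \<partial>lborel) + ennreal K * (\<integral>\<^sup>+x\<in>D. ?G x \<partial>lborel))"
      unfolding Q_def K_def using D \<eta>(1)
      by (intro mult_left_mono add_left_mono cone_average_integral_le) auto
    also have "\<dots> = ennreal (C * (1 + K)) * (\<integral>\<^sup>+x\<in>D. ?G x \<partial>lborel)"
      using C K by (simp add: ennreal_mult distrib_left distrib_right mult.assoc)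
    finally show "(\<integral>\<^sup>+x\<in>D. ennreal (\<bar>u x\<bar> powr p / bdist D x powr (s * p) * bdist D x powr \<beta>) \<partial>lborel)
      \<le> ennreal (C * (1 + K)) * (\<integral>\<^sup>+x\<in>D. (\<integral>\<^sup>+y\<in>D.
             ennreal (\<bar>u x - u y\<bar> powr p / dist x y powr (real DIM('a) + s * p)
                      * bdist D x powr \<beta>) \<partial>lborel) \<partial>lborel)"
      by (simp add: energy_density_def energy_kernel_def)
  qed
qed

theorem corollary4:
  fixes D :: "'a::euclidean_space set"
    and \<kappa> p s \<beta> :: real
  assumes "0 < \<kappa>" and "\<kappa> < 1"
    and "1 < p"
    and "0 < s * p - \<beta>" and "s * p - \<beta> < real DIM('a)"
    and "0 \<le> real DIM('a) + s * p"
    and "open D" and "D \<noteq> {}" and "D \<noteq> UNIV"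
    and "plump \<kappa> D"
    and "uniformly_fat (s - \<beta> / p) p (frontier D) \<or>
         (bounded D \<and> locally_uniformly_fat (s - \<beta> / p) p (frontier D))"
  shows "hardy_inequality s p \<beta> D"
proof -
  have \<sigma>: "(s - \<beta> / p) * p = s * p - \<beta>"
    using \<open>1 < p\<close> by (simp add: field_simps)
  have "\<exists>lam c. real DIM('a) + \<beta> - s * p < lam \<and> 0 < c \<and> (\<forall>x\<in>D. \<forall>z\<in>frontier D.
      ennreal (c * bdist D x powr lam) \<le> hausdorff_content lam (ball z (bdist D x) \<inter> frontier D))"
    using assms(11)
  proof
    assume "uniformly_fat (s - \<beta> / p) p (frontier D)"
    then obtain lam c where "real DIM('a) - (s - \<beta> / p) * p < lam" "0 < c"
      and fat: "\<forall>z\<in>frontier D. \<forall>R>0. ennreal (c * R powr lam) \<le> hausdorff_content lam (ball z R \<inter> frontier D)"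
      unfolding uniformly_fat_def by blast
    moreover have "0 < bdist D x" if "x \<in> D" for x
      using that assms by (intro bdist_pos)
    ultimately show ?thesis
      unfolding \<sigma> by (intro exI[of _ lam] exI[of _ c]) auto
  next
    assume loc: "bounded D \<and> locally_uniformly_fat (s - \<beta> / p) p (frontier D)"
    then obtain lam c where "real DIM('a) - (s - \<beta> / p) * p < lam" "0 < c"
      and fat: "\<forall>z\<in>frontier D. \<forall>R>0. ennreal R < 2 * ediam (frontier D) \<longrightarrow>
        ennreal (c * R powr lam) \<le> hausdorff_content lam (ball z R \<inter> frontier D)"
      unfolding locally_uniformly_fat_def by blast
    \<comment> \<open>Local fatness is assumed only for radii below twice the diameter of the boundary.\<close>
    moreover have "0 < bdist D x \<and> ennreal (bdist D x) < 2 * ediam (frontier D)" if "x \<in> D" for x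
    proof
      show pos: "0 < bdist D x" using that assms by (intro bdist_pos)
      have "ennreal (bdist D x) < ennreal (2 * bdist D x)"
        using pos by (intro ennreal_lessI) auto
      also have "\<dots> \<le> 1 * ediam (frontier D)"
        using twice_bdist_le_ediam_frontier[of D x] that assms loc by simp
      also have "\<dots> \<le> 2 * ediam (frontier D)"
        by (intro mult_right_mono) auto
      finally show "ennreal (bdist D x) < 2 * ediam (frontier D)" .
    qed
    ultimately show ?thesis
      unfolding \<sigma> by (intro exI[of _ lam] exI[of _ c]) auto
  qed
  then obtain lam c where lam: "real DIM('a) + \<beta> - s * p < lam" "0 < c"
    and fat: "\<And>x z. x \<in> D \<Longrightarrow> z \<in> frontier D \<Longrightarrow>
      ennreal (c * bdist D x powr lam) \<le> hausdorff_content lam (ball z (bdist D x) \<inter> frontier D)"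
    by blast
  show ?thesis
    by (rule hardy_inequality_of_fatness[OF _ _ _ _ _ _ _ lam fat]) (use assms in auto)
qed

end
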